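(* Let $h_3$ be the third Hermite function. There exist points $z_1,\dots,z_7\in\mathbb{R}^2$ such that the periodic structure $\Gamma=\bigcup_{k=1}^7\left((\sqrt3\,\mathbb{Z}\times\tfrac{1}{\sqrt3}\mathbb{Z})+z_k\right)$ has density $7$ and the Gabor system $\mathcal{G}(h_3,\Gamma)$ is not a frame for $L^2(\mathbb{R})$.
   Context: The $n$-th Hermite function is $h_n(t)=(-1)^nC_n e^{\pi t^2}\frac{d^n}{dt^n}\left(e^{-2\pi t^2}\right)$ with $C_n=2^{1/4}/\sqrt{n!(2\pi)^n2^n}$. For $z=(x,\omega)\in\mathbb{R}^2$ the time-frequency shift is $\pi(z)f(t)=e^{2\pi i\omega t}f(t-x)$. For $\Gamma\subset\mathbb{R}^2$, the Gabor system $\mathcal{G}(g,\Gamma)=\{\pi(\gamma)g\mid\gamma\in\Gamma\}$ is a frame for $L^2(\mathbb{R})$ if there are constants $0<A\le B<\infty$ with $A\|f\|_{L^2}^2\le\sum_{\gamma\in\Gamma}|\langle f,\pi(\gamma)g\rangle|^2\le B\|f\|_{L^2}^2$ for all $f\in L^2(\mathbb{R})$. For a lattice $\Lambda\subset\mathbb{R}^2$ and points $z_1,\dots,z_M$ that are pairwise distinct modulo $\Lambda$, the periodic structure $\bigcup_{m=1}^M(\Lambda+z_m)$ has density $M/\mathrm{vol}(\mathbb{R}^2/\Lambda)$; thus density $7$ here means that $z_1,\dots,z_7$ are pairwise distinct modulo $\sqrt3\,\mathbb{Z}\times\tfrac{1}{\sqrt3}\mathbb{Z}$. *)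

theory Defs
  imports "HOL-Analysis.Analysis"
begin

definition hermite_const :: "nat \<Rightarrow> real" where
  "hermite_const n = 2 powr (1/4) / sqrt (fact n * (2 * pi) ^ n * 2 ^ n)"

definition hermite_fun :: "nat \<Rightarrow> real \<Rightarrow> real" where
  "hermite_fun n t =
     (- 1) ^ n * hermite_const n * exp (pi * t\<^sup>2) * (deriv ^^ n) (\<lambda>s. exp (- 2 * pi * s\<^sup>2)) t"

definition tf_shift :: "real \<times> real \<Rightarrow> (real \<Rightarrow> complex) \<Rightarrow> real \<Rightarrow> complex" where
  "tf_shift z f t = exp (2 * of_real pi * \<i> * of_real (snd z) * of_real t) * f (t - fst z)"

text \<open>Elements of L2 are represented by functions; nothing below distinguishes functions that
  agree almost everywhere.\<close>

definition L2 :: "(real \<Rightarrow> complex) set" where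
  "L2 = {f. f \<in> borel_measurable lebesgue \<and> integrable lebesgue (\<lambda>t. (norm (f t))\<^sup>2)}"

definition L2_inner :: "(real \<Rightarrow> complex) \<Rightarrow> (real \<Rightarrow> complex) \<Rightarrow> complex" where
  "L2_inner f g = (\<integral>t. f t * cnj (g t) \<partial>lebesgue)"

definition L2_normsq :: "(real \<Rightarrow> complex) \<Rightarrow> real" where
  "L2_normsq f = (\<integral>t. (norm (f t))\<^sup>2 \<partial>lebesgue)"

text \<open>The sum is taken in \<^typ>\<open>ennreal\<close>, so that a divergent sum is infinite and violates the upper
  bound (in \<^typ>\<open>real\<close> it would be 0).\<close>

definition L2_frame :: "('i \<Rightarrow> real \<Rightarrow> complex) \<Rightarrow> 'i set \<Rightarrow> bool" where
  "L2_frame e I \<longleftrightarrow>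
     (\<exists>A B :: real. 0 < A \<and> A \<le> B \<and>
        (\<forall>f\<in>L2.
           ennreal (A * L2_normsq f) \<le> (\<Sum>\<^sub>\<infinity>i\<in>I. ennreal ((norm (L2_inner f (e i)))\<^sup>2)) \<and>
           (\<Sum>\<^sub>\<infinity>i\<in>I. ennreal ((norm (L2_inner f (e i)))\<^sup>2)) \<le> ennreal (B * L2_normsq f)))"

definition gabor_frame :: "(real \<Rightarrow> complex) \<Rightarrow> (real \<times> real) set \<Rightarrow> bool" where
  "gabor_frame g \<Gamma> \<longleftrightarrow> L2_frame (\<lambda>\<gamma>. tf_shift \<gamma> g) \<Gamma>"

definition lattice_of :: "real \<times> real \<Rightarrow> real \<times> real \<Rightarrow> (real \<times> real) set" where
  "lattice_of u v = {of_int m *\<^sub>R u + of_int n *\<^sub>R v | m n :: int. True}"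

text \<open>The area of the fundamental parallelogram spanned by \<open>u\<close> and \<open>v\<close>.\<close>

definition covolume :: "real \<times> real \<Rightarrow> real \<times> real \<Rightarrow> real" where
  "covolume u v = \<bar>fst u * snd v - snd u * fst v\<bar>"

definition periodic_structure ::
    "real \<times> real \<Rightarrow> real \<times> real \<Rightarrow> nat \<Rightarrow> (nat \<Rightarrow> real \<times> real) \<Rightarrow> (real \<times> real) set" where
  "periodic_structure u v M z = (\<Union>k\<in>{1..M}. (\<lambda>p. p + z k) ` lattice_of u v)"

definition has_periodic_density ::
    "real \<times> real \<Rightarrow> real \<times> real \<Rightarrow> nat \<Rightarrow> (nat \<Rightarrow> real \<times> real) \<Rightarrow> real \<Rightarrow> bool" where
  "has_periodic_density u v M z d \<longleftrightarrow>
     covolume u v \<noteq> 0 \<and>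
     (\<forall>j\<in>{1..M}. \<forall>k\<in>{1..M}. j \<noteq> k \<longrightarrow> z j - z k \<notin> lattice_of u v) \<and>
     d = real M / covolume u v"

lemma lattice_of_rectangular:
  "lattice_of (a, 0) (0, b) = range (\<lambda>m::int. a * of_int m) \<times> range (\<lambda>n::int. b * of_int n)"
  by (auto simp: lattice_of_def mult.commute)

lemma has_periodic_density_7_iff:
  "has_periodic_density (sqrt 3, 0) (0, 1 / sqrt 3) 7 z 7 \<longleftrightarrow>
     (\<forall>j\<in>{1..7}. \<forall>k\<in>{1..7}. j \<noteq> k \<longrightarrow> z j - z k \<notin> lattice_of (sqrt 3, 0) (0, 1 / sqrt 3))"
  by (simp add: has_periodic_density_def covolume_def)

end

theory Submission
  imports Defs
begin

text \<open>Over the critical lattice \<open>a\<int> \<times> (1/a)\<int>\<close> the system \<open>G(g, \<Lambda> + z)\<close> is diagonalised by the Zak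
  transform, with symbol \<open>\<bar>Zg(\<cdot> - z)\<bar>\<^sup>2\<close>. If every \<open>- z\<^sub>k\<close> is a zero of \<open>Zg\<close>, all symbols vanish at the
  origin, so the lower frame bound fails on functions whose Zak transform concentrates there; truncated
  combs of short intervals around \<open>a\<int>\<close> are such functions. It remains to find seven zeros of
  \<open>Zh\<^sub>3\<close> modulo \<open>\<Lambda>\<close>. Since \<open>h\<^sub>3\<close> is odd, there are zeros at \<open>(0, 0)\<close>, \<open>(a/2, 0)\<close> and \<open>(0, 1/(2a))\<close>.
  On each of the lines \<open>\<omega> = 0\<close> and \<open>\<omega> = 1/(2a)\<close> the (real, odd) function \<open>Zh\<^sub>3\<close> changes sign between
  \<open>a/6\<close> and \<open>5a/12\<close>, which gives two pairs \<open>\<plusminus>\<theta>\<close> of further zeros.\<close>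

section \<open>The Zak transform\<close>

lemma summable_on_int:
  fixes f :: "int \<Rightarrow> real"
  assumes "\<And>j. f j \<ge> 0" "summable (\<lambda>n. f (int n))" "summable (\<lambda>n. f (- int n))"
  shows "f summable_on UNIV"
proof -
  \<comment> \<open>The negative half starts at -1, so that 0 is counted only once.\<close>
  have "summable (\<lambda>n. f (- int (Suc n)))"
    using assms(3) by (subst summable_Suc_iff[of "\<lambda>n. f (- int n)"])
  then have "(f \<circ> (\<lambda>n. - int (Suc n))) summable_on UNIV"
    unfolding o_def by (rule summable_nonneg_imp_summable_on) (rule assms(1))
  moreover have "(f \<circ> int) summable_on UNIV"
    unfolding o_def using assms(2,1) by (rule summable_nonneg_imp_summable_on)
  ultimately have "f summable_on range int" "f summable_on range (\<lambda>n. - int (Suc n))"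
    by (subst summable_on_reindex; simp add: inj_on_def)+
  then have "f summable_on (range int \<union> range (\<lambda>n. - int (Suc n)))"
    by (rule summable_on_Un_disjoint) auto
  moreover have "j \<in> range int \<union> range (\<lambda>n. - int (Suc n))" for j
    by (cases j rule: int_cases) auto
  then have "range int \<union> range (\<lambda>n. - int (Suc n)) = UNIV"
    by (intro UNIV_eq_I[symmetric])
  ultimately show ?thesis by simp
qed

text \<open>Weierstrass M-test for unordered sums: outside a finite \<open>X\<close> the tail of
  \<open>f\<close> is dominated, uniformly in \<open>t\<close>, by the tail of
  \<open>B\<close>.\<close>

lemma uniform_limit_infsum:
  fixes f :: "'i \<Rightarrow> 'a \<Rightarrow> 'b::banach"
  assumes bound: "\<And>j t. j \<in> A \<Longrightarrow> t \<in> S \<Longrightarrow> norm (f j t) \<le> B j"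
    and B: "B summable_on A"
  shows "uniform_limit S (\<lambda>X t. \<Sum>j\<in>X. f j t) (\<lambda>t. \<Sum>\<^sub>\<infinity>j\<in>A. f j t) (finite_subsets_at_top A)"
proof (rule uniform_limitI)
  fix e :: real assume "e > 0"
  have "\<forall>\<^sub>F X in finite_subsets_at_top A. dist (sum B X) (infsum B A) < e"
    using infsum_tendsto[OF B] \<open>e > 0\<close> by (rule tendstoD)
  moreover have "\<forall>\<^sub>F X in finite_subsets_at_top A. finite X \<and> X \<subseteq> A"
    by (rule eventually_finite_subsets_at_top_weakI) auto
  ultimately show "\<forall>\<^sub>F X in finite_subsets_at_top A. \<forall>t\<in>S.
      dist (\<Sum>j\<in>X. f j t) (\<Sum>\<^sub>\<infinity>j\<in>A. f j t) < e"
  proof eventually_elim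
    case (elim X)
    show ?case
    proof
      fix t assume t: "t \<in> S"
      have summ: "B summable_on (A - X)"
        using B by (rule summable_on_subset_banach) auto
      have abs: "(\<lambda>j. norm (f j t)) summable_on A"
        using bound[OF _ t] by (intro summable_on_comparison_test[OF B]) auto
      have "(\<Sum>\<^sub>\<infinity>j\<in>A. f j t) - (\<Sum>j\<in>X. f j t) = (\<Sum>\<^sub>\<infinity>j\<in>A - X. f j t)"
        using elim abs by (subst infsum_Diff) (auto intro: abs_summable_summable)
      also have "norm \<dots> \<le> infsum B (A - X)"
        by (rule norm_infsum_le[OF has_sum_infsum has_sum_infsum])
          (use elim t bound abs summ in \<open>auto intro: summable_on_subset_banach[OF abs_summable_summable]\<close>)
      also have "\<dots> = infsum B A - sum B X"
        using elim B by (subst infsum_Diff) auto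
      also have "\<dots> < e"
        using elim by (auto simp: dist_real_def)
      finally show "dist (\<Sum>j\<in>X. f j t) (\<Sum>\<^sub>\<infinity>j\<in>A. f j t) < e"
        by (simp add: dist_norm norm_minus_commute)
    qed
  qed
qed

text \<open>Replacing \<open>j\<close> by \<open>- j\<close> gives the usual form, the sum over k of
  g(x - a k) exp(2 pi i a k \<omega>). A normalising factor sqrt a is left out, as it does not
  affect the zeros.\<close>

definition zak :: "real \<Rightarrow> (real \<Rightarrow> complex) \<Rightarrow> real \<Rightarrow> real \<Rightarrow> complex" where
  "zak a g x \<omega> = (\<Sum>\<^sub>\<infinity>j. g (x + a * of_int j) * cis (- 2 * pi * a * \<omega> * of_int j))"

definition exp_decay :: "(real \<Rightarrow> complex) \<Rightarrow> bool" where
  "exp_decay g \<longleftrightarrow> (\<exists>K. \<forall>t. norm (g t) \<le> K * exp (- \<bar>t\<bar>))"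

text \<open>Since |t + a j| is at least a |j| - R, the number K exp(R - a |j|) serves all
  \<open>t\<close> in the window at once. The weight 1 + |j| prepares the comb estimate, where a
  translation by \<open>j\<close> disturbs a number of terms proportional to |j|.\<close>

lemma exp_decay_bound:
  assumes "exp_decay g" "a > 0"
  obtains B :: "int \<Rightarrow> real"
  where "\<And>t j. \<bar>t\<bar> \<le> R \<Longrightarrow> norm (g (t + a * of_int j)) \<le> B j" "\<And>j. B j \<ge> 0"
    "(\<lambda>j. (1 + of_int \<bar>j\<bar>) * B j) summable_on UNIV" "B summable_on UNIV"
proof -
  obtain K where K: "\<And>t. norm (g t) \<le> K * exp (- \<bar>t\<bar>)"
    using assms by (auto simp: exp_decay_def)
  have K0: "K \<ge> 0"
    using order_trans[OF norm_ge_zero K[of 0]] by simp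
  define B where "B j = K * exp (R - a * of_int \<bar>j\<bar>)" for j :: int
  have B0: "B j \<ge> 0" for j
    using K0 by (simp add: B_def)
  have "norm (g (t + a * of_int j)) \<le> B j" if "\<bar>t\<bar> \<le> R" for t j
  proof -
    have "a * of_int \<bar>j\<bar> = \<bar>a * of_int j\<bar>"
      using assms by (simp add: abs_mult)
    then have "- \<bar>t + a * of_int j\<bar> \<le> R - a * of_int \<bar>j\<bar>"
      using that by linarith
    then have "K * exp (- \<bar>t + a * of_int j\<bar>) \<le> B j"
      unfolding B_def using K0 by (intro mult_left_mono) auto
    with K[of "t + a * of_int j"] show ?thesis by linarith
  qed
  moreover have *: "(\<lambda>j. (1 + of_int \<bar>j\<bar>) * B j) summable_on UNIV"
  proof -
    \<comment> \<open>Half of the decay exp(- a n) absorbs the factor 1 + n; the other half remains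
      as the geometric ratio \<open>r\<close>.\<close>
    define r where "r = exp (- a / 2)"
    have r: "0 < r" "r < 1"
      using assms by (auto simp: r_def)
    have "summable (\<lambda>n. (1 + real n) * B (int n))"
    proof (rule summable_comparison_test')
      show "summable (\<lambda>n. (1 + 2 / a) * (K * exp R) * r ^ n)"
        using r by (intro summable_mult summable_geometric) auto
      fix n :: nat
      have "1 + real n \<le> (1 + 2 / a) * exp (a / 2 * real n)"
      proof -
        have "a / 2 * real n \<le> exp (a / 2 * real n)"
          using exp_ge_add_one_self[of "a / 2 * real n"] by linarith
        then have "2 / a * (a / 2 * real n) \<le> 2 / a * exp (a / 2 * real n)"
          using assms by (intro mult_left_mono) auto
        then have "real n \<le> 2 / a * exp (a / 2 * real n)"
          using assms by simp
        moreover have "1 \<le> exp (a / 2 * real n)"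
          using assms by simp
        ultimately have "1 + real n \<le> exp (a / 2 * real n) + 2 / a * exp (a / 2 * real n)"
          by (rule add_mono[rotated])
        then show ?thesis
          by (simp only: distrib_right mult_1)
      qed
      then have "(1 + real n) * B (int n) \<le> (1 + 2 / a) * exp (a / 2 * real n) * B (int n)"
        using B0 by (rule mult_right_mono)
      also have "\<dots> = (1 + 2 / a) * (K * exp R) * (exp (a / 2 * real n) * exp (- a * real n))"
        by (simp add: B_def exp_diff exp_minus field_simps)
      also have "exp (a / 2 * real n) * exp (- a * real n) = r ^ n"
        by (simp add: r_def exp_add[symmetric] exp_of_nat_mult[symmetric])
      finally show "norm ((1 + real n) * B (int n)) \<le> (1 + 2 / a) * (K * exp R) * r ^ n"
        using B0[of "int n"] by simp
    qed
    then show ?thesis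
      using B0 by (intro summable_on_int) (auto simp: B_def)
  qed
  moreover have "B summable_on UNIV"
    using * by (rule summable_on_comparison_test) (use B0 in \<open>auto simp: algebra_simps\<close>)
  ultimately show ?thesis
    using B0 by (intro that)
qed

lemma zak_abs_summable:
  assumes "exp_decay g" "a > 0"
  shows "(\<lambda>j. norm (g (x + a * of_int j) * cis (- 2 * pi * a * \<omega> * of_int j))) summable_on UNIV"
proof -
  obtain B where B: "\<And>t j. \<bar>t\<bar> \<le> \<bar>x\<bar> \<Longrightarrow> norm (g (t + a * of_int j)) \<le> B j" "B summable_on UNIV"
    by (rule exp_decay_bound[OF assms]) blast
  show ?thesis
    by (rule summable_on_comparison_test[OF B(2)]) (use B(1) in \<open>auto simp: norm_mult\<close>)
qed

lemma uniform_limit_zak: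
  assumes "exp_decay g" "a > 0"
  shows "uniform_limit {-R..R} (\<lambda>X t. \<Sum>j\<in>X. g (t + a * of_int j) * cis (- 2 * pi * a * \<omega> * of_int j))
    (\<lambda>t. zak a g t \<omega>) (finite_subsets_at_top UNIV)"
proof -
  obtain B where B: "\<And>t j. \<bar>t\<bar> \<le> R \<Longrightarrow> norm (g (t + a * of_int j)) \<le> B j" "B summable_on UNIV"
    by (rule exp_decay_bound[OF assms]) blast
  show ?thesis
    unfolding zak_def by (rule uniform_limit_infsum[OF _ B(2)]) (use B(1) in \<open>auto simp: norm_mult\<close>)
qed

text \<open>The partial sums are continuous and converge uniformly on bounded intervals, and every
  point is interior to such an interval.\<close>

lemma continuous_on_zak:
  assumes "exp_decay g" "a > 0" "continuous_on UNIV g"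
  shows "continuous_on UNIV (\<lambda>t. zak a g t \<omega>)"
proof -
  have c: "continuous_on S (\<lambda>t. \<Sum>j\<in>X. g (t + a * of_int j) * cis (- 2 * pi * a * \<omega> * of_int j))" for X S
    by (intro continuous_intros continuous_on_compose2[OF assms(3)]) auto
  have c': "continuous_on {-R..R} (\<lambda>t. zak a g t \<omega>)" for R
  proof (rule uniform_limit_theorem)
    show "uniform_limit {-R..R} (\<lambda>X t. \<Sum>j\<in>X. g (t + a * of_int j) * cis (- 2 * pi * a * \<omega> * of_int j))
        (\<lambda>t. zak a g t \<omega>) (finite_subsets_at_top UNIV)"
      by (rule uniform_limit_zak[OF assms(1,2)])
  qed (intro always_eventually allI c, rule finite_subsets_at_top_neq_bot)
  have "isCont (\<lambda>t. zak a g t \<omega>) x" for x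
  proof (rule continuous_on_interior[OF c'[of "\<bar>x\<bar> + 1"]])
    show "x \<in> interior {- (\<bar>x\<bar> + 1)..\<bar>x\<bar> + 1}"
      unfolding interior_atLeastAtMost_real by (simp add: abs_if)
  qed
  then show ?thesis
    by (intro continuous_at_imp_continuous_on) blast
qed

section \<open>The test functions\<close>

lemma card_translate_diff_le:
  fixes N j :: int
  shows "card {m. (m + j \<in> {-N..N}) \<noteq> (m \<in> {-N..N})} \<le> 4 * nat \<bar>j\<bar>"
    "finite {m. (m + j \<in> {-N..N}) \<noteq> (m \<in> {-N..N})}"
proof -
  \<comment> \<open>Membership changes only near the end points \<open>- N\<close> and
    \<open>N\<close>; a window of 2 |j| integers around each covers both signs of
    \<open>j\<close>.\<close>
  have sub: "{m. (m + j \<in> {-N..N}) \<noteq> (m \<in> {-N..N})}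
      \<subseteq> {-N-\<bar>j\<bar>..<-N+\<bar>j\<bar>} \<union> {N-\<bar>j\<bar><..N+\<bar>j\<bar>}" (is "_ \<subseteq> ?I \<union> ?J")
    by auto
  have "card (?I \<union> ?J) \<le> card ?I + card ?J" by (rule card_Un_le)
  also have "\<dots> = 4 * nat \<bar>j\<bar>" by simp
  finally have "card (?I \<union> ?J) \<le> 4 * nat \<bar>j\<bar>" .
  then show "card {m. (m + j \<in> {-N..N}) \<noteq> (m \<in> {-N..N})} \<le> 4 * nat \<bar>j\<bar>"
    using card_mono[OF _ sub] by simp
  show "finite {m. (m + j \<in> {-N..N}) \<noteq> (m \<in> {-N..N})}"
    using sub by (rule finite_subset) auto
qed

text \<open>Writing \<open>c\<close> for the indicator of \<open>{-N..N}\<close>, the inner sum is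
  \<open>c m * (\<Sum>j. G j) + (\<Sum>j. G j * (c (m + j) - c m))\<close>: a small total sum of \<open>G\<close> leaves only the
  boundary effects, which do not grow with \<open>N\<close>.\<close>

lemma sum_norm_square_correlation_le:
  fixes G :: "int \<Rightarrow> complex" and N :: int
  assumes "finite X" "finite M" "N \<ge> 0"
    and X: "\<And>l m. l \<in> {-N..N} \<Longrightarrow> m \<in> M \<Longrightarrow> l - m \<in> X"
    and small: "norm (\<Sum>j\<in>X. G j) \<le> \<eta>"
    and C: "(\<Sum>j\<in>X. (1 + of_int \<bar>j\<bar>) * norm (G j)) \<le> C"
  shows "(\<Sum>m\<in>M. (norm (\<Sum>l\<in>{-N..N}. G (l - m)))\<^sup>2) \<le> 2 * \<eta>\<^sup>2 * of_int (2 * N + 1) + 8 * C\<^sup>2"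
proof -
  define c :: "int \<Rightarrow> real" where "c m = of_bool (m \<in> {-N..N})" for m
  define D where "D j m = \<bar>c (m + j) - c m\<bar>" for j m
  define S where "S = (\<Sum>j\<in>X. norm (G j))"
  have D01: "(D j m)\<^sup>2 = D j m" "D j m = of_bool ((m + j \<in> {-N..N}) \<noteq> (m \<in> {-N..N}))" for j m
    by (auto simp: D_def c_def)
  have c01: "(c m)\<^sup>2 = c m" for m by (simp add: c_def)
  have eta: "\<eta> \<ge> 0" using small norm_ge_zero order_trans by blast
  have S0: "0 \<le> S" by (auto simp: S_def intro: sum_nonneg)
  have SC: "S \<le> C"
    using C by (rule order_trans[rotated]) (auto simp: S_def algebra_simps intro!: sum_mono)
  have pt: "(norm (\<Sum>l\<in>{-N..N}. G (l - m)))\<^sup>2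
      \<le> 2 * \<eta>\<^sup>2 * c m + 2 * S * (\<Sum>j\<in>X. norm (G j) * D j m)" if m: "m \<in> M" for m
  proof -
    have "(\<Sum>l\<in>{-N..N}. G (l - m)) = (\<Sum>j\<in>(\<lambda>l. l - m) ` {-N..N}. G j)"
      by (subst sum.reindex) (auto simp: inj_on_def)
    \<comment> \<open>All differences \<open>l - m\<close> lie in \<open>X\<close>; the remaining
      indices of \<open>X\<close> receive the coefficient \<open>c (m + j) = 0\<close>.\<close>
    also have "\<dots> = (\<Sum>j\<in>X. c (m + j) * G j)"
    proof (rule sum.mono_neutral_cong_left)
      show "finite X" by fact
      show "(\<lambda>l. l - m) ` {-N..N} \<subseteq> X"
        by (rule image_subsetI) (rule X[OF _ m])
      show "\<forall>i\<in>X - (\<lambda>l. l - m) ` {-N..N}. c (m + i) * G i = 0"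
      proof
        fix i assume "i \<in> X - (\<lambda>l. l - m) ` {-N..N}"
        then have "m + i \<notin> {-N..N}"
          by (metis Diff_iff add_diff_cancel_left' image_eqI)
        then show "c (m + i) * G i = 0" by (simp add: c_def)
      qed
    qed (auto simp: c_def)
    also have "\<dots> = c m * (\<Sum>j\<in>X. G j) + (\<Sum>j\<in>X. (c (m + j) - c m) * G j)"
      by (simp add: sum_distrib_left sum_subtractf left_diff_distrib)
    finally have eq: "(\<Sum>l\<in>{-N..N}. G (l - m)) = \<dots>" .
    have n1: "norm (c m * (\<Sum>j\<in>X. G j)) \<le> c m * \<eta>"
      using small by (simp add: norm_mult c_def)
    have n2: "norm (\<Sum>j\<in>X. (c (m + j) - c m) * G j) \<le> (\<Sum>j\<in>X. D j m * norm (G j))"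
      by (rule order_trans[OF norm_sum]) (simp add: norm_mult D_def flip: of_real_diff)
    have "(norm (\<Sum>l\<in>{-N..N}. G (l - m)))\<^sup>2 \<le> (c m * \<eta> + (\<Sum>j\<in>X. D j m * norm (G j)))\<^sup>2"
      unfolding eq by (intro power_mono order_trans[OF norm_triangle_ineq] add_mono n1 n2) auto
    also have "\<dots> \<le> 2 * (c m * \<eta>)\<^sup>2 + 2 * (\<Sum>j\<in>X. D j m * norm (G j))\<^sup>2"
      using sum_squares_bound[of "c m * \<eta>" "\<Sum>j\<in>X. D j m * norm (G j)"]
      by (simp add: power2_sum)
    \<comment> \<open>Each weight is split into two square roots before Cauchy-Schwarz. As
      \<open>D j m\<close> is 0 or 1 and equals its square, the result is linear in \<open>D\<close>
      and can be summed over \<open>m\<close>.\<close>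
    also have "(\<Sum>j\<in>X. D j m * norm (G j))\<^sup>2 = (\<Sum>j\<in>X. sqrt (norm (G j)) * (D j m * sqrt (norm (G j))))\<^sup>2"
      by (simp add: mult.left_commute)
    also have "\<dots> \<le> (\<Sum>j\<in>X. (sqrt (norm (G j)))\<^sup>2) * (\<Sum>j\<in>X. (D j m * sqrt (norm (G j)))\<^sup>2)"
      by (rule Cauchy_Schwarz_ineq_sum)
    also have "\<dots> = S * (\<Sum>j\<in>X. norm (G j) * D j m)"
      by (simp add: S_def power_mult_distrib D01(1) mult.commute)
    also have "(c m * \<eta>)\<^sup>2 = \<eta>\<^sup>2 * c m"
      by (simp add: power_mult_distrib c01)
    finally show ?thesis by simp
  qed
  have csum: "(\<Sum>m\<in>M. c m) \<le> of_int (2 * N + 1)"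
  proof -
    have "(\<Sum>m\<in>M. c m) = real (card (M \<inter> {-N..N}))"
      using \<open>finite M\<close> by (simp add: c_def atLeastAtMost_def atLeast_def atMost_def Collect_conj_eq flip: of_nat_sum)
    also have "card (M \<inter> {-N..N}) \<le> card {-N..N}" by (rule card_mono) auto
    finally show ?thesis using \<open>N \<ge> 0\<close> by simp
  qed
  \<comment> \<open>Only indices near the boundary contribute, so the bound involves neither
    \<open>N\<close> nor \<open>M\<close>.\<close>
  have Dsum: "(\<Sum>m\<in>M. D j m) \<le> 4 * of_int \<bar>j\<bar>" for j
  proof -
    have "(\<Sum>m\<in>M. D j m) = real (card (M \<inter> {m. (m + j \<in> {-N..N}) \<noteq> (m \<in> {-N..N})}))"
      unfolding D01(2) using \<open>finite M\<close> by (simp add: Collect_conj_eq flip: of_nat_sum)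
    also have "card (M \<inter> {m. (m + j \<in> {-N..N}) \<noteq> (m \<in> {-N..N})})
        \<le> card {m. (m + j \<in> {-N..N}) \<noteq> (m \<in> {-N..N})}"
      by (intro card_mono card_translate_diff_le Int_lower2)
    also note card_translate_diff_le(1)
    finally show ?thesis by simp
  qed
  have "(\<Sum>m\<in>M. (norm (\<Sum>l\<in>{-N..N}. G (l - m)))\<^sup>2)
      \<le> (\<Sum>m\<in>M. 2 * \<eta>\<^sup>2 * c m + 2 * S * (\<Sum>j\<in>X. norm (G j) * D j m))"
    by (intro sum_mono pt)
  also have "\<dots> = 2 * \<eta>\<^sup>2 * (\<Sum>m\<in>M. c m) + 2 * S * (\<Sum>m\<in>M. \<Sum>j\<in>X. norm (G j) * D j m)"
    by (simp only: sum.distrib sum_distrib_left[symmetric])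
  also have "(\<Sum>m\<in>M. \<Sum>j\<in>X. norm (G j) * D j m) = (\<Sum>j\<in>X. norm (G j) * (\<Sum>m\<in>M. D j m))"
    by (subst sum.swap) (simp add: sum_distrib_left)
  also have "2 * S * \<dots> \<le> 2 * S * (\<Sum>j\<in>X. norm (G j) * (4 * of_int \<bar>j\<bar>))"
    using S0 by (intro mult_left_mono sum_mono Dsum) auto
  also have "\<dots> \<le> 2 * S * (4 * C)"
  proof -
    have "(\<Sum>j\<in>X. norm (G j) * (4 * of_int \<bar>j\<bar>)) = 4 * (\<Sum>j\<in>X. of_int \<bar>j\<bar> * norm (G j))"
      by (simp add: sum_distrib_left mult_ac)
    also have "(\<Sum>j\<in>X. of_int \<bar>j\<bar> * norm (G j)) \<le> (\<Sum>j\<in>X. (1 + of_int \<bar>j\<bar>) * norm (G j))"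
      by (intro sum_mono mult_right_mono) auto
    finally show ?thesis using S0 C by (intro mult_left_mono) auto
  qed
  also have "2 * S * (4 * C) \<le> 8 * C\<^sup>2"
    using mult_right_mono[OF SC order_trans[OF S0 SC]] by (simp add: power2_eq_square)
  finally show ?thesis
    using mult_left_mono[OF csum, of "2 * \<eta>\<^sup>2"] by simp
qed

section \<open>Bessel's inequality\<close>

lemma Bessel_inequality:
  fixes h :: "'a \<Rightarrow> complex" and e :: "'i \<Rightarrow> 'a \<Rightarrow> complex"
  assumes "finite I" "a > 0"
    and h2: "integrable M (\<lambda>t. (norm (h t))\<^sup>2)"
    and he: "\<And>i. i \<in> I \<Longrightarrow> integrable M (\<lambda>t. h t * cnj (e i t))"
    and ee: "\<And>i j. i \<in> I \<Longrightarrow> j \<in> I \<Longrightarrow> integrable M (\<lambda>t. e i t * cnj (e j t))"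
    and orth: "\<And>i j. i \<in> I \<Longrightarrow> j \<in> I \<Longrightarrow> (\<integral>t. e i t * cnj (e j t) \<partial>M) = (if i = j then of_real a else 0)"
  shows "(\<Sum>i\<in>I. (norm (\<integral>t. h t * cnj (e i t) \<partial>M))\<^sup>2) \<le> a * (\<integral>t. (norm (h t))\<^sup>2 \<partial>M)"
proof -
  define c where "c i = (\<integral>t. h t * cnj (e i t) \<partial>M)" for i
  define S where "S = (\<Sum>i\<in>I. (norm (c i))\<^sup>2)"
  \<comment> \<open>The orthogonal projection of \<open>h\<close> onto the span of the
    \<open>e i\<close>; the division by \<open>a\<close> accounts for their squared norm
    \<open>a\<close>. Expanding the square norm of \<open>h - P\<close>, which is nonnegative,
    leaves that of \<open>h\<close> minus \<open>S / a\<close>.\<close>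
  define P where "P t = (\<Sum>i\<in>I. c i / a * e i t)" for t
  have [simp]: "c i * cnj (c i) = of_real ((norm (c i))\<^sup>2)" for i
    by (simp only: complex_norm_square)
  have h2c: "integrable M (\<lambda>t. h t * cnj (h t))"
    using integrable_of_real[OF h2, where 'a=complex] by (simp only: complex_norm_square)
  have hP: "integrable M (\<lambda>t. h t * cnj (P t))"
  proof -
    have "integrable M (\<lambda>t. \<Sum>i\<in>I. cnj (c i) / a * (h t * cnj (e i t)))"
      using he by (intro Bochner_Integration.integrable_sum integrable_mult_right)
    then show ?thesis by (simp add: P_def sum_distrib_left mult_ac)
  qed
  have Ph: "integrable M (\<lambda>t. P t * cnj (h t))"
    using integrable_cnj[OF hP] by (simp add: mult.commute)
  have PPeq: "P t * cnj (P t) = (\<Sum>i\<in>I. \<Sum>j\<in>I. c i * cnj (c j) / (a * a) * (e i t * cnj (e j t)))" for t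
    by (simp add: P_def sum_product mult_ac)
  have PP: "integrable M (\<lambda>t. P t * cnj (P t))"
    unfolding PPeq using ee by (intro Bochner_Integration.integrable_sum integrable_mult_right)
  have iPP: "(\<integral>t. P t * cnj (P t) \<partial>M) = of_real (S / a)"
  proof -
    have int: "integrable M (\<lambda>t. c i * cnj (c j) / (a * a) * (e i t * cnj (e j t)))"
      if "i \<in> I" "j \<in> I" for i j
      using ee[OF that] by (rule integrable_mult_right)
    have "(\<integral>t. P t * cnj (P t) \<partial>M)
        = (\<Sum>i\<in>I. \<integral>t. (\<Sum>j\<in>I. c i * cnj (c j) / (a * a) * (e i t * cnj (e j t))) \<partial>M)"
      unfolding PPeq by (rule Bochner_Integration.integral_sum) (intro Bochner_Integration.integrable_sum int)
    also have "\<dots> = (\<Sum>i\<in>I. \<Sum>j\<in>I. \<integral>t. c i * cnj (c j) / (a * a) * (e i t * cnj (e j t)) \<partial>M)"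
      by (intro sum.cong refl Bochner_Integration.integral_sum int)
    also have "\<dots> = (\<Sum>i\<in>I. \<Sum>j\<in>I. c i * cnj (c j) / (a * a) * (\<integral>t. e i t * cnj (e j t) \<partial>M))"
      by (simp only: integral_mult_right_zero)
    also have "\<dots> = (\<Sum>i\<in>I. c i * cnj (c i) / (a * a) * of_real a)"
      using \<open>finite I\<close> by (intro sum.cong refl) (simp add: orth if_distrib sum.delta cong: if_cong)
    also have "\<dots> = of_real (S / a)"
      using \<open>a > 0\<close> by (simp add: S_def sum_divide_distrib)
    finally show ?thesis .
  qed
  have ihP: "(\<integral>t. h t * cnj (P t) \<partial>M) = of_real (S / a)"
  proof -
    have "(\<integral>t. h t * cnj (P t) \<partial>M) = (\<integral>t. (\<Sum>i\<in>I. cnj (c i) / a * (h t * cnj (e i t))) \<partial>M)"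
      by (simp add: P_def sum_distrib_left mult_ac)
    also have "\<dots> = (\<Sum>i\<in>I. cnj (c i) / a * c i)"
      using he by (subst Bochner_Integration.integral_sum) (auto simp: c_def)
    also have "\<dots> = of_real (S / a)"
      by (simp add: S_def sum_divide_distrib mult.commute)
    finally show ?thesis .
  qed
  have iPh: "(\<integral>t. P t * cnj (h t) \<partial>M) = of_real (S / a)"
  proof -
    have "(\<integral>t. P t * cnj (h t) \<partial>M) = (\<integral>t. cnj (h t * cnj (P t)) \<partial>M)"
      by (simp add: mult.commute)
    also have "\<dots> = cnj (\<integral>t. h t * cnj (P t) \<partial>M)"
      by (rule Bochner_Integration.integral_cnj)
    finally show ?thesis by (simp add: ihP)
  qed
  have "of_real (\<integral>t. (norm (h t - P t))\<^sup>2 \<partial>M) = (\<integral>t. (h t - P t) * cnj (h t - P t) \<partial>M)"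
    by (simp only: complex_norm_square[symmetric] integral_complex_of_real)
  also have "\<dots> = (\<integral>t. h t * cnj (h t) - h t * cnj (P t) - P t * cnj (h t) + P t * cnj (P t) \<partial>M)"
    by (simp add: algebra_simps)
  also have "\<dots> = (\<integral>t. h t * cnj (h t) \<partial>M) - of_real (S / a)"
    using h2c hP Ph PP by (simp add: iPP ihP iPh)
  also have "(\<integral>t. h t * cnj (h t) \<partial>M) = of_real (\<integral>t. (norm (h t))\<^sup>2 \<partial>M)"
    by (simp only: complex_norm_square[symmetric] integral_complex_of_real)
  finally have "(\<integral>t. (norm (h t - P t))\<^sup>2 \<partial>M) = (\<integral>t. (norm (h t))\<^sup>2 \<partial>M) - S / a"
    by (simp only: of_real_eq_iff flip: of_real_diff)
  moreover have "0 \<le> (\<integral>t. (norm (h t - P t))\<^sup>2 \<partial>M)"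
    by (rule Bochner_Integration.integral_nonneg) simp
  ultimately have "S / a \<le> (\<integral>t. (norm (h t))\<^sup>2 \<partial>M)"
    by linarith
  then show ?thesis
    using \<open>a > 0\<close> by (simp add: S_def c_def field_simps)
qed

lemma integrable_indicator_bounded:
  fixes f :: "real \<Rightarrow> complex"
  assumes "f \<in> borel_measurable borel" "\<And>t. t \<in> {u..v} \<Longrightarrow> norm (f t) \<le> B"
  shows "integrable lborel (\<lambda>t. indicator {u..v} t * f t)"
proof -
  have "integrable lborel (\<lambda>t. indicator {u..v} t *\<^sub>R f t)"
    using assms by (intro integrableI_bounded_set_indicator) (auto simp: emeasure_lborel_Icc_eq)
  moreover have "indicator {u..v} t *\<^sub>R f t = indicator {u..v} t * f t" for t
    by (simp add: indicator_def)
  ultimately show ?thesis by simp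
qed

lemma integral_cis_period:
  fixes n :: int
  assumes "a > 0"
  shows "(\<integral>t. indicator {-a/2..a/2} t * cis (2 * pi * of_int n * t / a) \<partial>lborel) = (if n = 0 then of_real a else 0)"
proof (cases "n = 0")
  case True
  have "(\<integral>t. indicator {-a/2..a/2} t * cis (2 * pi * of_int n * t / a) \<partial>lborel)
      = (\<integral>t. of_real (indicator {-a/2..a/2} t) \<partial>lborel)"
    using True by (intro Bochner_Integration.integral_cong) (auto simp: indicator_def)
  also have "\<dots> = of_real (measure lborel {-a/2..a/2})"
    by (simp only: integral_complex_of_real) simp
  finally show ?thesis using True assms by simp
next
  case False
  define w where "w = 2 * pi * of_int n / a"
  have w: "w \<noteq> 0" using False assms by (simp add: w_def)
  define F where "F t = cis (w * t) / (\<i> * w)" for t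
  have F': "(F has_vector_derivative cis (w * t)) (at t within S)" for t S
  proof -
    have "((\<lambda>z. exp (\<i> * w * z) / (\<i> * w)) has_field_derivative exp (\<i> * w * of_real t)) (at (of_real t))"
      using w by (auto intro!: derivative_eq_intros)
    from has_vector_derivative_real_field[OF this] show ?thesis
      by (simp add: F_def[abs_def] cis_conv_exp mult_ac)
  qed
  have "(\<integral>t. indicator {-a/2..a/2} t *\<^sub>R cis (w * t) \<partial>lborel) = F (a/2) - F (-a/2)"
    by (rule integral_FTC_Icc) (use assms F' in \<open>auto intro!: continuous_intros\<close>)
  \<comment> \<open>For nonzero \<open>n\<close> the antiderivative has period \<open>a\<close>, as
    \<open>w * a\<close> is a whole number of turns.\<close>
  also have "F (a/2) = F (-a/2)"
  proof -
    have "w * (a/2) = w * (-a/2) + 2 * pi * of_int n"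
      using assms by (simp add: w_def field_simps)
    then have "cis (w * (a/2)) = cis (w * (-a/2)) * cis (2 * pi * of_int n)"
      unfolding cis_mult by (rule arg_cong)
    also have "cis (2 * pi * of_int n) = 1"
      by (simp add: cis_multiple_2pi)
    finally show ?thesis unfolding F_def by (simp only: mult_1_right)
  qed
  finally have "(\<integral>t. indicator {-a/2..a/2} t *\<^sub>R cis (w * t) \<partial>lborel) = 0" by simp
  moreover have "indicator {-a/2..a/2} t *\<^sub>R cis (w * t) = indicator {-a/2..a/2} t * cis (2 * pi * of_int n * t / a)" for t
    by (simp add: indicator_def w_def)
  ultimately show ?thesis using False by simp
qed

text \<open>The exponentials, cut off to one period, are orthogonal on the real line with squared
  norm \<open>a\<close>. The cut-off disappears from the coefficients of \<open>h\<close> because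
  \<open>h\<close> is supported in that period.\<close>

lemma Fourier_Bessel_inequality:
  fixes h :: "real \<Rightarrow> complex"
  assumes "a > 0" "finite I" and [measurable]: "h \<in> borel_measurable borel"
    and B: "\<And>t. norm (h t) \<le> B" and supp: "\<And>t. t \<notin> {-a/2..a/2} \<Longrightarrow> h t = 0"
  shows "(\<Sum>n\<in>I. (norm (\<integral>t. h t * cis (- 2 * pi * of_int n * t / a) \<partial>lborel))\<^sup>2)
    \<le> a * (\<integral>t. (norm (h t))\<^sup>2 \<partial>lborel)"
proof -
  define e :: "int \<Rightarrow> real \<Rightarrow> complex" where
    "e n t = indicator {-a/2..a/2} t * cis (2 * pi * of_int n * t / a)" for n t
  have cis_meas [measurable]: "cis \<in> borel_measurable borel"
    by (intro borel_measurable_continuous_onI continuous_intros)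
  have he: "h t * cnj (e n t) = h t * cis (- 2 * pi * of_int n * t / a)" for n t
    using supp by (auto simp: e_def indicator_def cis_cnj)
  have ee: "e m t * cnj (e n t) = indicator {-a/2..a/2} t * cis (2 * pi * of_int (m - n) * t / a)" for m n t
    by (auto simp: e_def indicator_def cis_cnj cis_mult algebra_simps diff_divide_distrib add_divide_distrib)
  have "integrable lborel (\<lambda>t. (norm (h t))\<^sup>2)"
  proof (rule integrableI_bounded_set[where A="{-a/2..a/2}" and B="B\<^sup>2"])
    show "AE t in lborel. t \<in> {-a/2..a/2} \<longrightarrow> norm ((norm (h t))\<^sup>2) \<le> B\<^sup>2"
      using B by (auto intro!: power_mono)
  qed (use supp in \<open>auto simp: emeasure_lborel_Icc_eq\<close>)
  moreover have "integrable lborel (\<lambda>t. h t * cnj (e n t))" for n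
  proof -
    have "integrable lborel (\<lambda>t. indicator {-a/2..a/2} t * (h t * cis (- 2 * pi * of_int n * t / a)))"
      by (rule integrable_indicator_bounded[where B=B]) (use B in \<open>auto simp: norm_mult\<close>)
    moreover have "indicator {-a/2..a/2} t * (h t * z) = h t * z" for t z
      using supp[of t] by (auto simp: indicator_def)
    ultimately show ?thesis
      by (simp only: he)
  qed
  moreover have "integrable lborel (\<lambda>t. e m t * cnj (e n t))" for m n
    unfolding ee by (rule integrable_indicator_bounded[where B=1]) auto
  moreover have "(\<integral>t. e m t * cnj (e n t) \<partial>lborel) = (if m = n then of_real a else 0)" for m n
    unfolding ee using integral_cis_period[OF \<open>a > 0\<close>, of "m - n"] by simp
  ultimately show ?thesis
    using Bessel_inequality[of I a lborel h e] \<open>finite I\<close> \<open>a > 0\<close> by (simp add: he)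
qed

section \<open>Combs and their inner products with time-frequency shifts\<close>

definition comb :: "real \<Rightarrow> real \<Rightarrow> int \<Rightarrow> real \<Rightarrow> complex" where
  "comb a \<epsilon> N = indicator (\<Union>l\<in>{-N..N}. {a * of_int l - \<epsilon>..a * of_int l + \<epsilon>})"

lemma disjoint_family_comb:
  fixes a \<epsilon> :: real
  assumes "2 * \<epsilon> < a"
  shows "disjoint_family_on (\<lambda>l::int. {a * of_int l - \<epsilon>..a * of_int l + \<epsilon>}) S"
proof -
  have "False" if "t \<in> {a * of_int l - \<epsilon>..a * of_int l + \<epsilon>}" "t \<in> {a * of_int k - \<epsilon>..a * of_int k + \<epsilon>}"
    "l < k" for t and l k :: int
  proof -
    \<comment> \<open>A nonempty interval forces \<epsilon> to be nonnegative, and then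
      \<open>2 * \<epsilon> < a\<close> gives \<open>a > 0\<close>.\<close>
    have "\<epsilon> \<ge> 0" using that(1) unfolding atLeastAtMost_iff by linarith
    have "of_int l + 1 \<le> (of_int k :: real)" using that by linarith
    then have "a * (of_int l + 1) \<le> a * of_int k"
      using assms \<open>\<epsilon> \<ge> 0\<close> by (intro mult_left_mono) auto
    then show False using that assms by (simp add: algebra_simps)
  qed
  then show ?thesis
    unfolding disjoint_family_on_def by (metis disjoint_iff linorder_neqE)
qed

lemma comb_eq_sum:
  assumes "2 * \<epsilon> < a"
  shows "comb a \<epsilon> N t = (\<Sum>l\<in>{-N..N}. indicator {-\<epsilon>..\<epsilon>} (t - a * of_int l))"
proof -
  have "comb a \<epsilon> N t = (\<Sum>l\<in>{-N..N}. indicator {a * of_int l - \<epsilon>..a * of_int l + \<epsilon>} t)"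
    unfolding comb_def by (rule indicator_UN_disjoint[OF _ disjoint_family_comb[OF assms]]) simp
  also have "\<dots> = (\<Sum>l\<in>{-N..N}. indicator {-\<epsilon>..\<epsilon>} (t - a * of_int l))"
    by (intro sum.cong refl) (auto simp: indicator_def)
  finally show ?thesis .
qed

lemma comb_measurable [measurable]: "comb a \<epsilon> N \<in> borel_measurable borel"
  unfolding comb_def by (intro borel_measurable_indicator sets.finite_UN) auto

lemma norm_comb_square:
  "(norm (comb a \<epsilon> N t))\<^sup>2 = indicator (\<Union>l\<in>{-N..N}. {a * of_int l - \<epsilon>..a * of_int l + \<epsilon>}) t"
  by (simp add: comb_def indicator_def)

lemma
  assumes "2 * \<epsilon> < a" "\<epsilon> > 0" "N \<ge> 0"
  shows comb_in_L2: "comb a \<epsilon> N \<in> L2"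
    and L2_normsq_comb: "L2_normsq (comb a \<epsilon> N) = of_int (2 * N + 1) * (2 * \<epsilon>)"
proof -
  let ?E = "\<Union>l\<in>{-N..N}. {a * of_int l - \<epsilon>..a * of_int l + \<epsilon>}"
  have E [measurable]: "?E \<in> sets borel" by (intro sets.finite_UN) auto
  have hb: "has_bochner_integral lborel (\<lambda>t. (norm (comb a \<epsilon> N t))\<^sup>2) (of_int (2 * N + 1) * (2 * \<epsilon>))"
  proof -
    have "has_bochner_integral lborel
        (\<lambda>t. \<Sum>l\<in>{-N..N}. indicator {a * of_int l - \<epsilon>..a * of_int l + \<epsilon>} t)
        (\<Sum>l\<in>{-N..N}. measure lborel {a * of_int l - \<epsilon>..a * of_int l + \<epsilon>})"
      by (intro has_bochner_integral_sum has_bochner_integral_real_indicator)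
        (auto simp: emeasure_lborel_Icc_eq)
    moreover have "(\<Sum>l\<in>{-N..N}. indicator {a * of_int l - \<epsilon>..a * of_int l + \<epsilon>} t) = (norm (comb a \<epsilon> N t))\<^sup>2" for t
      unfolding norm_comb_square
      by (rule indicator_UN_disjoint[OF _ disjoint_family_comb[OF assms(1)], symmetric]) simp
    moreover have "(\<Sum>l\<in>{-N..N}. measure lborel {a * of_int l - \<epsilon>..a * of_int l + \<epsilon>}) = of_int (2 * N + 1) * (2 * \<epsilon>)"
      using assms by simp
    ultimately show ?thesis by simp
  qed
  then have "integrable lebesgue (\<lambda>t. (norm (comb a \<epsilon> N t))\<^sup>2)"
    by (subst integrable_completion) (auto simp: has_bochner_integral_iff)
  then show "comb a \<epsilon> N \<in> L2"
    by (simp add: L2_def measurable_completion)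
  have "L2_normsq (comb a \<epsilon> N) = (\<integral>t. (norm (comb a \<epsilon> N t))\<^sup>2 \<partial>lborel)"
    unfolding L2_normsq_def by (rule integral_completion) simp
  with hb show "L2_normsq (comb a \<epsilon> N) = of_int (2 * N + 1) * (2 * \<epsilon>)"
    by (simp add: has_bochner_integral_integral_eq)
qed

text \<open>Every tooth of the comb is translated onto the central interval. The inner product
  thereby becomes the \<open>n\<close>-th Fourier coefficient, with period \<open>a\<close>, of a
  function that depends on \<open>m\<close> but not on \<open>n\<close>: a truncated, conjugated Zak
  sum, cut off to the central interval. This prepares Bessel's inequality in
  \<open>n\<close>.\<close>

lemma L2_inner_comb_tf_shift:
  fixes g :: "real \<Rightarrow> complex" and m n N :: int
  assumes g: "continuous_on UNIV g" and "a > 0" "2 * \<epsilon> < a"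
  shows "L2_inner (comb a \<epsilon> N) (tf_shift (a * of_int m + x, of_int n / a + \<omega>) g)
    = (\<integral>t. indicator {-\<epsilon>..\<epsilon>} t * (cis (- 2 * pi * \<omega> * t) *
          (\<Sum>l\<in>{-N..N}. cnj (g (t - x + a * of_int (l - m))) * cis (- 2 * pi * a * \<omega> * of_int l)))
        * cis (- 2 * pi * of_int n * t / a) \<partial>lborel)"
proof -
  let ?w = "of_int n / a + \<omega>"
  define \<phi> where "\<phi> t = cis (- 2 * pi * ?w * t) * cnj (g (t - a * of_int m - x))" for t
  have tf: "cnj (tf_shift (a * of_int m + x, ?w) g t) = \<phi> t" for t
    by (simp add: tf_shift_def \<phi>_def cis_conv_exp exp_cnj algebra_simps)
  have c: "continuous_on UNIV \<phi>"
    unfolding \<phi>_def by (intro continuous_intros continuous_on_compose2[OF g]) auto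
  then have [measurable]: "\<phi> \<in> borel_measurable borel"
    by (rule borel_measurable_continuous_onI)
  have int: "integrable lborel (\<lambda>t. indicator {-\<epsilon>..\<epsilon>} t * \<phi> (a * of_int l + t))" for l
  proof -
    have "compact ((\<lambda>t. \<phi> (a * of_int l + t)) ` {-\<epsilon>..\<epsilon>})"
      by (intro compact_continuous_image continuous_intros continuous_on_compose2[OF c]) auto
    then obtain B where "\<forall>y\<in>(\<lambda>t. \<phi> (a * of_int l + t)) ` {-\<epsilon>..\<epsilon>}. norm y \<le> B"
      by (auto dest!: compact_imp_bounded simp only: bounded_iff)
    then show ?thesis
      by (intro integrable_indicator_bounded) auto
  qed
  have int': "integrable lborel (\<lambda>t. indicator {-\<epsilon>..\<epsilon>} (t - a * of_int l) * \<phi> t)" for l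
    by (subst lborel_integrable_real_affine_iff[of 1 _ "a * of_int l", symmetric]) (use int in auto)
  have shift: "cis (- 2 * pi * ?w * (a * of_int l + t))
      = cis (- 2 * pi * \<omega> * t) * cis (- 2 * pi * a * \<omega> * of_int l) * cis (- 2 * pi * of_int n * t / a)" for l :: int and t
  proof -
    \<comment> \<open>The lattice steps \<open>a\<close> and 1 / a have product 1, so the modulation
      by n / a meets the translation by a l in a whole number of turns, which drops out.\<close>
    have "- 2 * pi * ?w * (a * of_int l + t) = - 2 * pi * \<omega> * t + - 2 * pi * a * \<omega> * of_int l
        + - 2 * pi * of_int n * t / a + 2 * pi * of_int (- n * l)"
      using \<open>a > 0\<close> by (simp add: field_simps)
    then have "cis (- 2 * pi * ?w * (a * of_int l + t)) = cis (- 2 * pi * \<omega> * t) * cis (- 2 * pi * a * \<omega> * of_int l)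
        * cis (- 2 * pi * of_int n * t / a) * cis (2 * pi * of_int (- n * l))"
      by (simp only: cis_mult)
    also have "cis (2 * pi * of_int (- n * l)) = 1"
      by (rule cis_multiple_2pi) simp
    finally show ?thesis by (simp only: mult_1_right)
  qed
  have "L2_inner (comb a \<epsilon> N) (tf_shift (a * of_int m + x, ?w) g) = (\<integral>t. comb a \<epsilon> N t * \<phi> t \<partial>lborel)"
    unfolding L2_inner_def tf by (rule integral_completion) simp
  also have "\<dots> = (\<integral>t. (\<Sum>l\<in>{-N..N}. indicator {-\<epsilon>..\<epsilon>} (t - a * of_int l) * \<phi> t) \<partial>lborel)"
    by (simp add: comb_eq_sum[OF assms(3)] sum_distrib_right)
  also have "\<dots> = (\<Sum>l\<in>{-N..N}. \<integral>t. indicator {-\<epsilon>..\<epsilon>} (t - a * of_int l) * \<phi> t \<partial>lborel)"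
    by (rule Bochner_Integration.integral_sum) (rule int')
  also have "\<dots> = (\<Sum>l\<in>{-N..N}. \<integral>t. indicator {-\<epsilon>..\<epsilon>} t * \<phi> (a * of_int l + t) \<partial>lborel)"
  proof (intro sum.cong refl)
    fix l
    show "(\<integral>t. indicator {-\<epsilon>..\<epsilon>} (t - a * of_int l) * \<phi> t \<partial>lborel)
        = (\<integral>t. indicator {-\<epsilon>..\<epsilon>} t * \<phi> (a * of_int l + t) \<partial>lborel)"
      using lborel_integral_real_affine[of 1 "\<lambda>t. indicator {-\<epsilon>..\<epsilon>} (t - a * of_int l) * \<phi> t" "a * of_int l"]
      by simp
  qed
  also have "\<dots> = (\<integral>t. (\<Sum>l\<in>{-N..N}. indicator {-\<epsilon>..\<epsilon>} t * \<phi> (a * of_int l + t)) \<partial>lborel)"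
    by (rule Bochner_Integration.integral_sum[symmetric]) (rule int)
  also have "(\<lambda>t. \<Sum>l\<in>{-N..N}. indicator {-\<epsilon>..\<epsilon>} t * \<phi> (a * of_int l + t))
    = (\<lambda>t. indicator {-\<epsilon>..\<epsilon>} t * (cis (- 2 * pi * \<omega> * t) *
          (\<Sum>l\<in>{-N..N}. cnj (g (t - x + a * of_int (l - m))) * cis (- 2 * pi * a * \<omega> * of_int l)))
        * cis (- 2 * pi * of_int n * t / a))" (is "?L = ?R")
  proof
    fix t
    have "\<phi> (a * of_int l + t) = cis (- 2 * pi * \<omega> * t) * (cnj (g (t - x + a * of_int (l - m)))
        * cis (- 2 * pi * a * \<omega> * of_int l)) * cis (- 2 * pi * of_int n * t / a)" for l
    proof -
      have "a * of_int l + t - a * of_int m - x = t - x + a * of_int (l - m)"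
        by (simp add: algebra_simps)
      then show ?thesis
        unfolding \<phi>_def shift by (simp only: mult_ac)
    qed
    then show "?L t = ?R t"
      by (simp only: sum_distrib_left sum_distrib_right mult.assoc)
  qed
  finally show ?thesis .
qed

text \<open>Bessel's inequality in \<open>n\<close> and the correlation estimate in \<open>m\<close>
  bound the energy collected from one translate of the lattice. The comb has squared norm 2
  \<epsilon> (2 N + 1), so the \<eta> term is a small multiple of it, and the \<open>C\<close> term
  becomes negligible for large \<open>N\<close>. It matters that \<open>C\<close> is fixed before
  \<eta>, \<epsilon> and \<open>N\<close>.\<close>

lemma comb_energy_bound:
  assumes g: "continuous_on UNIV g" "exp_decay g" and "a > 0" and zero: "zak a g (- x) (- \<omega>) = 0"
  obtains C where "\<And>\<eta>. \<eta> > 0 \<Longrightarrow> \<exists>\<epsilon>0>0. \<forall>\<epsilon> N MM NN. 0 < \<epsilon> \<longrightarrow> \<epsilon> \<le> \<epsilon>0 \<longrightarrow> 2 * \<epsilon> < a \<longrightarrow> N \<ge> 0 \<longrightarrow>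
      finite MM \<longrightarrow> finite NN \<longrightarrow>
      (\<Sum>m\<in>MM. \<Sum>n\<in>NN. (norm (L2_inner (comb a \<epsilon> N) (tf_shift (a * of_int m + x, of_int n / a + \<omega>) g)))\<^sup>2)
      \<le> a * (2 * \<epsilon>) * (2 * \<eta>\<^sup>2 * of_int (2 * N + 1) + 8 * C\<^sup>2)"
proof -
  \<comment> \<open>The radius is large enough for all \<open>t - x\<close> with |t| at most
    1.\<close>
  obtain B where B: "\<And>t j. \<bar>t\<bar> \<le> \<bar>x\<bar> + 1 \<Longrightarrow> norm (g (t + a * of_int j)) \<le> B j" "\<And>j. B j \<ge> 0"
    "(\<lambda>j. (1 + of_int \<bar>j\<bar>) * B j) summable_on UNIV"
    by (rule exp_decay_bound[OF g(2) \<open>a > 0\<close>, of "\<bar>x\<bar> + 1"]) blast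
  define C where "C = (\<Sum>\<^sub>\<infinity>j. (1 + of_int \<bar>j\<bar>) * B j)"
  have "\<exists>\<epsilon>0>0. \<forall>\<epsilon> N MM NN. 0 < \<epsilon> \<longrightarrow> \<epsilon> \<le> \<epsilon>0 \<longrightarrow> 2 * \<epsilon> < a \<longrightarrow> N \<ge> 0 \<longrightarrow>
      finite MM \<longrightarrow> finite NN \<longrightarrow>
      (\<Sum>m\<in>MM. \<Sum>n\<in>NN. (norm (L2_inner (comb a \<epsilon> N) (tf_shift (a * of_int m + x, of_int n / a + \<omega>) g)))\<^sup>2)
      \<le> a * (2 * \<epsilon>) * (2 * \<eta>\<^sup>2 * of_int (2 * N + 1) + 8 * C\<^sup>2)" if "\<eta> > 0" for \<eta>
  proof -
    have cont: "isCont (\<lambda>t. zak a g t (- \<omega>)) (- x)"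
      using continuous_on_zak[OF g(2) \<open>a > 0\<close> g(1)] by (simp add: continuous_on_eq_continuous_at)
    obtain \<delta> where \<delta>0: "\<delta> > 0"
      "\<forall>u. dist u (- x) < \<delta> \<longrightarrow> dist (zak a g u (- \<omega>)) (zak a g (- x) (- \<omega>)) < \<eta> / 2"
      using cont[unfolded continuous_at_eps_delta, rule_format, OF half_gt_zero[OF \<open>\<eta> > 0\<close>]] by (elim exE conjE)
    have \<delta>: "\<delta> > 0" "\<And>u. dist u (- x) < \<delta> \<Longrightarrow> norm (zak a g u (- \<omega>)) < \<eta> / 2"
      using \<delta>0 by (simp_all add: zero)
    \<comment> \<open>The bound 1 keeps \<open>t - x\<close> where the majorant \<open>B\<close> is
      valid; \<delta> / 2 keeps it strictly within \<delta> of the zero \<open>- x\<close>.\<close>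
    define \<epsilon>0 where "\<epsilon>0 = min 1 (\<delta> / 2)"
    show ?thesis
    proof (intro exI[of _ \<epsilon>0] conjI allI impI)
      show "\<epsilon>0 > 0" using \<delta> by (simp add: \<epsilon>0_def)
      fix \<epsilon> and N :: int and MM NN :: "int set"
      assume eps: "0 < \<epsilon>" "\<epsilon> \<le> \<epsilon>0" "2 * \<epsilon> < a" and N: "N \<ge> 0" and fin: "finite MM" "finite NN"
      define G where "G t j = g (t - x + a * of_int j) * cis (- 2 * pi * a * (- \<omega>) * of_int j)" for t j
      define H where "H m t = cis (- 2 * pi * \<omega> * t) *
          (\<Sum>l\<in>{-N..N}. cnj (g (t - x + a * of_int (l - m))) * cis (- 2 * pi * a * \<omega> * of_int l))" for m t
      define Q where "Q = 2 * \<eta>\<^sup>2 * of_int (2 * N + 1) + 8 * C\<^sup>2"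
      have Q0: "Q \<ge> 0" using N by (simp add: Q_def)
      have norm_H: "norm (H m t) = norm (\<Sum>l\<in>{-N..N}. G t (l - m))" for m t
      proof -
        \<comment> \<open>Conjugation and a phase depending only on \<open>m\<close> relate the two
          sums; both preserve the modulus.\<close>
        have "cnj (\<Sum>l\<in>{-N..N}. G t (l - m)) = cis (2 * pi * a * \<omega> * of_int m) *
          (\<Sum>l\<in>{-N..N}. cnj (g (t - x + a * of_int (l - m))) * cis (- 2 * pi * a * \<omega> * of_int l))"
          unfolding sum_distrib_left cnj_sum
        proof (intro sum.cong refl)
          fix l
          have "cnj (cis (- 2 * pi * a * (- \<omega>) * of_int (l - m)))
              = cis (2 * pi * a * \<omega> * of_int m) * cis (- 2 * pi * a * \<omega> * of_int l)"
            unfolding cis_mult cis_cnj by (rule arg_cong[where f=cis]) (simp add: algebra_simps)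
          then show "cnj (G t (l - m)) = cis (2 * pi * a * \<omega> * of_int m) *
            (cnj (g (t - x + a * of_int (l - m))) * cis (- 2 * pi * a * \<omega> * of_int l))"
            unfolding G_def complex_cnj_mult by (simp only: mult_ac)
        qed
        then have "norm (cnj (\<Sum>l\<in>{-N..N}. G t (l - m))) = norm (H m t)"
          by (simp only: H_def norm_mult norm_cis)
        then show ?thesis by (simp only: complex_mod_cnj)
      qed
      have sumH: "(\<Sum>m\<in>MM. (norm (H m t))\<^sup>2) \<le> Q" if t: "t \<in> {-\<epsilon>..\<epsilon>}" for t
      proof -
        define P where "P X \<longleftrightarrow> (\<forall>u\<in>{-(\<bar>x\<bar>+1)..\<bar>x\<bar>+1}.
            dist (\<Sum>j\<in>X. g (u + a * of_int j) * cis (- 2 * pi * a * (- \<omega>) * of_int j)) (zak a g u (- \<omega>)) < \<eta> / 2)" for X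
        have "eventually P (finite_subsets_at_top UNIV)"
          using uniform_limitD[OF uniform_limit_zak[OF g(2) \<open>a > 0\<close>, where R="\<bar>x\<bar> + 1" and \<omega>="- \<omega>"] half_gt_zero[OF \<open>\<eta> > 0\<close>]]
          unfolding P_def .
        then obtain X0 where X0: "finite X0" "\<And>X. finite X \<Longrightarrow> X0 \<subseteq> X \<Longrightarrow> P X"
          unfolding eventually_finite_subsets_at_top by auto
        \<comment> \<open>\<open>X\<close> serves two purposes: it contains all differences
          \<open>l - m\<close>, and it contains \<open>X0\<close>, so that the partial sum over
          \<open>X\<close> is within \<eta> / 2 of the Zak transform. Continuity at the zero
          accounts for the other \<eta> / 2.\<close>
        define X where "X = X0 \<union> (\<lambda>(l, m). l - m) ` ({-N..N} \<times> MM)"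
        have X: "finite X" "X0 \<subseteq> X" using X0 fin by (auto simp: X_def)
        have tx: "\<bar>t - x\<bar> \<le> \<bar>x\<bar> + 1" "dist (t - x) (- x) < \<delta>"
          using t eps \<delta> by (auto simp: \<epsilon>0_def dist_real_def)
        have small: "norm (\<Sum>j\<in>X. G t j) \<le> \<eta>"
        proof -
          have "dist (\<Sum>j\<in>X. G t j) (zak a g (t - x) (- \<omega>)) < \<eta> / 2"
            using X0(2)[OF X] tx(1) unfolding P_def G_def by (simp add: abs_le_iff)
          moreover have "norm (zak a g (t - x) (- \<omega>)) < \<eta> / 2"
            using \<delta>(2)[OF tx(2)] .
          ultimately show ?thesis
            using norm_triangle_sub[of "\<Sum>j\<in>X. G t j" "zak a g (t - x) (- \<omega>)"] by (simp add: dist_norm)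
        qed
        have "(\<Sum>j\<in>X. (1 + of_int \<bar>j\<bar>) * norm (G t j)) \<le> (\<Sum>j\<in>X. (1 + of_int \<bar>j\<bar>) * B j)"
          using B(1)[OF tx(1)] by (intro sum_mono mult_left_mono) (auto simp: G_def norm_mult)
        also have "\<dots> \<le> C"
          unfolding C_def by (rule finite_sum_le_infsum[OF B(3) X(1)]) (use B(2) in auto)
        finally have GC: "(\<Sum>j\<in>X. (1 + of_int \<bar>j\<bar>) * norm (G t j)) \<le> C" .
        show ?thesis
          unfolding norm_H Q_def
          by (rule sum_norm_square_correlation_le[OF X(1) fin(1) N _ small GC]) (auto simp: X_def)
      qed
      have H_cont: "continuous_on UNIV (H m)" for m
        unfolding H_def by (intro continuous_intros continuous_on_compose2[OF g(1)]) auto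
      have H_meas [measurable]: "H m \<in> borel_measurable borel" for m
        using H_cont by (rule borel_measurable_continuous_onI)
      have H_sq: "(norm (H m t))\<^sup>2 \<le> Q" if "m \<in> MM" "t \<in> {-\<epsilon>..\<epsilon>}" for m t
        using member_le_sum[of m MM "\<lambda>m. (norm (H m t))\<^sup>2"] that fin sumH[OF that(2)] by simp
      then have H_bound: "norm (H m t) \<le> sqrt Q" if "m \<in> MM" "t \<in> {-\<epsilon>..\<epsilon>}" for m t
        using that by (intro real_le_rsqrt) auto
      have int: "integrable lborel (\<lambda>t. (norm (indicator {-\<epsilon>..\<epsilon>} t * H m t))\<^sup>2)" if "m \<in> MM" for m
        by (rule integrableI_bounded_set[where A="{-\<epsilon>..\<epsilon>}" and B=Q])
          (use H_sq[OF that] in \<open>auto simp: emeasure_lborel_Icc_eq indicator_def intro!: AE_I2\<close>)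
      have "(\<Sum>m\<in>MM. \<Sum>n\<in>NN. (norm (L2_inner (comb a \<epsilon> N) (tf_shift (a * of_int m + x, of_int n / a + \<omega>) g)))\<^sup>2)
        \<le> (\<Sum>m\<in>MM. a * (\<integral>t. (norm (indicator {-\<epsilon>..\<epsilon>} t * H m t))\<^sup>2 \<partial>lborel))"
      \<comment> \<open>For fixed \<open>m\<close> the inner products over \<open>n\<close> are
        Fourier coefficients of one and the same function.\<close>
      proof (rule sum_mono)
        fix m assume m: "m \<in> MM"
        show "(\<Sum>n\<in>NN. (norm (L2_inner (comb a \<epsilon> N) (tf_shift (a * of_int m + x, of_int n / a + \<omega>) g)))\<^sup>2)
          \<le> a * (\<integral>t. (norm (indicator {-\<epsilon>..\<epsilon>} t * H m t))\<^sup>2 \<partial>lborel)"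
          unfolding L2_inner_comb_tf_shift[OF g(1) \<open>a > 0\<close> eps(3)] H_def[symmetric]
          by (rule Fourier_Bessel_inequality[OF \<open>a > 0\<close> fin(2), where B="sqrt Q"])
            (use H_bound[OF m] eps Q0 in \<open>auto simp: indicator_def norm_mult\<close>)
      qed
      \<comment> \<open>The sum over \<open>m\<close> goes under the integral because
        \<open>sumH\<close> bounds the whole sum at each \<open>t\<close>; bounding each
        \<open>m\<close> separately would lose a factor growing with \<open>MM\<close>.\<close>
      also have "\<dots> = a * (\<integral>t. (\<Sum>m\<in>MM. (norm (indicator {-\<epsilon>..\<epsilon>} t * H m t))\<^sup>2) \<partial>lborel)"
        using int by (simp add: Bochner_Integration.integral_sum sum_distrib_left)
      also have "(\<integral>t. (\<Sum>m\<in>MM. (norm (indicator {-\<epsilon>..\<epsilon>} t * H m t))\<^sup>2) \<partial>lborel)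
          \<le> (\<integral>t. indicator {-\<epsilon>..\<epsilon>} t * Q \<partial>lborel)"
      proof (rule integral_mono)
        show "(\<Sum>m\<in>MM. (norm (indicator {-\<epsilon>..\<epsilon>} t * H m t))\<^sup>2) \<le> indicator {-\<epsilon>..\<epsilon>} t * Q" for t
          using sumH[of t] by (auto simp: indicator_def)
      qed (use int in \<open>auto simp: emeasure_lborel_Icc_eq\<close>)
      also have "\<dots> = 2 * \<epsilon> * Q"
        using eps by simp
      finally show "(\<Sum>m\<in>MM. \<Sum>n\<in>NN. (norm (L2_inner (comb a \<epsilon> N) (tf_shift (a * of_int m + x, of_int n / a + \<omega>) g)))\<^sup>2)
        \<le> a * (2 * \<epsilon>) * (2 * \<eta>\<^sup>2 * of_int (2 * N + 1) + 8 * C\<^sup>2)"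
        using \<open>a > 0\<close> by (simp add: Q_def)
    qed
  qed
  then show ?thesis by (rule that)
qed

section \<open>Failure of the lower frame bound\<close>

lemma periodic_structure_rectangular:
  "periodic_structure (a, 0) (0, b) M z
    = (\<lambda>(k, m, n). (a * of_int m + fst (z k), of_int n * b + snd (z k))) ` ({1..M} \<times> UNIV)"
  unfolding periodic_structure_def lattice_of_rectangular
  by (auto simp: image_iff mult.commute prod_eq_iff) (intro bexI conjI exI, (rule refl)+, simp)

text \<open>The parameters are chosen in the order \<eta>, \<epsilon>, \<open>N\<close>. First
  \<eta> makes the main terms of all \<open>M\<close> translates together at most half of what a
  lower bound \<open>A\<close> demands; then \<epsilon> is admissible for every translate; finally
  \<open>N\<close> pushes the boundary terms below the other half.\<close>

theorem not_gabor_frame_if_zak_zeros: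
  fixes g :: "real \<Rightarrow> complex"
  assumes g: "continuous_on UNIV g" "exp_decay g" and "a > 0"
    and zero: "\<And>k. k \<in> {1..M} \<Longrightarrow> zak a g (- fst (z k)) (- snd (z k)) = 0"
  shows "\<not> gabor_frame g (periodic_structure (a, 0) (0, 1 / a) M z)"
proof
  let ?\<Gamma> = "periodic_structure (a, 0) (0, 1 / a) M z"
  assume "gabor_frame g ?\<Gamma>"
  then obtain A where A: "A > 0" "\<And>f. f \<in> L2 \<Longrightarrow>
      ennreal (A * L2_normsq f) \<le> (\<Sum>\<^sub>\<infinity>\<gamma>\<in>?\<Gamma>. ennreal ((norm (L2_inner f (tf_shift \<gamma> g)))\<^sup>2))"
    unfolding gabor_frame_def L2_frame_def by blast
  define W where "W \<epsilon> N k m n = (norm (L2_inner (comb a \<epsilon> N)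
      (tf_shift (a * of_int m + fst (z k), of_int n / a + snd (z k)) g)))\<^sup>2" for \<epsilon> N k and m n :: int
  have "\<exists>C. \<forall>\<eta>>0. \<exists>\<epsilon>0>0. \<forall>\<epsilon> N MM NN. 0 < \<epsilon> \<longrightarrow> \<epsilon> \<le> \<epsilon>0 \<longrightarrow> 2 * \<epsilon> < a \<longrightarrow> N \<ge> 0 \<longrightarrow>
      finite MM \<longrightarrow> finite NN \<longrightarrow>
      (\<Sum>m\<in>MM. \<Sum>n\<in>NN. W \<epsilon> N k m n) \<le> a * (2 * \<epsilon>) * (2 * \<eta>\<^sup>2 * of_int (2 * N + 1) + 8 * C\<^sup>2)"
    if "k \<in> {1..M}" for k
    unfolding W_def by (rule comb_energy_bound[OF g \<open>a > 0\<close> zero[OF that]]) blast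
  then obtain C where C: "\<And>k \<eta>. k \<in> {1..M} \<Longrightarrow> \<eta> > 0 \<Longrightarrow> \<exists>\<epsilon>0>0. \<forall>\<epsilon> N MM NN. 0 < \<epsilon> \<longrightarrow> \<epsilon> \<le> \<epsilon>0 \<longrightarrow>
      2 * \<epsilon> < a \<longrightarrow> N \<ge> 0 \<longrightarrow> finite MM \<longrightarrow> finite NN \<longrightarrow>
      (\<Sum>m\<in>MM. \<Sum>n\<in>NN. W \<epsilon> N k m n) \<le> a * (2 * \<epsilon>) * (2 * \<eta>\<^sup>2 * of_int (2 * N + 1) + 8 * (C k)\<^sup>2)"
    by metis
  \<comment> \<open>The choice makes 2 a M \<eta>^2 equal to (A / 2) M / (M + 1); the denominator is
    positive even for \<open>M = 0\<close>.\<close>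
  define \<eta> where "\<eta> = sqrt (A / (4 * a * (real M + 1)))"
  have \<eta>: "\<eta> > 0" "2 * a * real M * \<eta>\<^sup>2 \<le> A / 2"
  proof -
    have pos: "A / (4 * a * (real M + 1)) > 0"
      using \<open>A > 0\<close> \<open>a > 0\<close> by (intro divide_pos_pos mult_pos_pos) auto
    then show "\<eta> > 0" by (simp add: \<eta>_def)
    have eta_sq: "\<eta>\<^sup>2 = A / (4 * a * (real M + 1))"
      unfolding \<eta>_def using pos by (intro real_sqrt_pow2) linarith
    have "2 * a * real M * \<eta>\<^sup>2 = A / 2 * (real M / (real M + 1))"
      unfolding eta_sq using \<open>a > 0\<close> by (simp add: divide_simps)
    also have "\<dots> \<le> A / 2 * 1"
      using \<open>A > 0\<close> by (intro mult_left_mono) auto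
    finally show "2 * a * real M * \<eta>\<^sup>2 \<le> A / 2" by simp
  qed
  from C[OF _ \<eta>(1)] obtain \<epsilon>0 where \<epsilon>0: "\<And>k. k \<in> {1..M} \<Longrightarrow> \<epsilon>0 k > 0"
    "\<And>k \<epsilon> N MM NN. k \<in> {1..M} \<Longrightarrow> 0 < \<epsilon> \<Longrightarrow> \<epsilon> \<le> \<epsilon>0 k \<Longrightarrow> 2 * \<epsilon> < a \<Longrightarrow> N \<ge> 0 \<Longrightarrow>
      finite MM \<Longrightarrow> finite NN \<Longrightarrow>
      (\<Sum>m\<in>MM. \<Sum>n\<in>NN. W \<epsilon> N k m n) \<le> a * (2 * \<epsilon>) * (2 * \<eta>\<^sup>2 * of_int (2 * N + 1) + 8 * (C k)\<^sup>2)"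
    by metis
  \<comment> \<open>Inserting a / 4 ensures \<open>2 * \<epsilon> < a\<close> and keeps the minimum
    over a nonempty set.\<close>
  define \<epsilon> where "\<epsilon> = Min (insert (a / 4) (\<epsilon>0 ` {1..M}))"
  have \<epsilon>: "\<epsilon> > 0" "2 * \<epsilon> < a" "\<And>k. k \<in> {1..M} \<Longrightarrow> \<epsilon> \<le> \<epsilon>0 k"
  proof -
    show "\<epsilon> > 0" unfolding \<epsilon>_def using \<epsilon>0(1) \<open>a > 0\<close> by (subst Min_gr_iff) auto
    have "\<epsilon> \<le> a / 4" unfolding \<epsilon>_def by (rule Min_le) auto
    then show "2 * \<epsilon> < a" using \<open>a > 0\<close> by simp
    show "\<epsilon> \<le> \<epsilon>0 k" if "k \<in> {1..M}" for k unfolding \<epsilon>_def using that by (intro Min_le) auto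
  qed
  define C' where "C' = (\<Sum>k\<in>{1..M}. 8 * (C k)\<^sup>2)"
  have C': "C' \<ge> 0" by (simp add: C'_def sum_nonneg)
  obtain N :: int where N: "N \<ge> 0" "a * C' < A / 2 * of_int (2 * N + 1)"
  proof
    \<comment> \<open>Already \<open>A * ?N\<close> reaches \<open>a * C'\<close>; the odd summand
      in 2 N + 1 adds A / 2 and makes the inequality strict.\<close>
    let ?N = "\<lceil>a * C' / A\<rceil>"
    show "?N \<ge> 0" using C' \<open>a > 0\<close> \<open>A > 0\<close> by (simp add: order_less_le_trans[of "-1" 0])
    have "A * (a * C' / A) \<le> A * of_int ?N"
      using \<open>A > 0\<close> by (intro mult_left_mono le_of_int_ceiling) auto
    moreover have "A * (a * C' / A) = a * C'" using \<open>A > 0\<close> by simp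
    ultimately show "a * C' < A / 2 * of_int (2 * ?N + 1)" using \<open>A > 0\<close> by (simp add: algebra_simps)
  qed
  define f where "f = comb a \<epsilon> N"
  define U where "U = 2 * \<epsilon> * (2 * a * real M * \<eta>\<^sup>2 * of_int (2 * N + 1) + a * C')"
  define pt where "pt = (\<lambda>(k, m, n). (a * of_int m + fst (z k), of_int n * (1 / a) + snd (z k)))"
  define E where "E \<gamma> = (norm (L2_inner f (tf_shift \<gamma> g)))\<^sup>2" for \<gamma>
  have E: "E (pt (k, m, n)) = W \<epsilon> N k m n" for k m n
    by (simp add: E_def f_def pt_def W_def)
  have finite_sum: "sum E F \<le> U" if F: "finite F" "F \<subseteq> ?\<Gamma>" for F
  proof -
    obtain T where T: "T \<subseteq> {1..M} \<times> UNIV" "finite T" "F = pt ` T"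
      using finite_subset_image[OF F(1)] F(2) unfolding periodic_structure_rectangular pt_def by blast
    define MM where "MM = (\<lambda>(k, m, n). m) ` T"
    define NN where "NN = (\<lambda>(k, m, n). n) ` T"
    have fin: "finite MM" "finite NN" using T(2) by (auto simp: MM_def NN_def)
    have sub: "T \<subseteq> {1..M} \<times> MM \<times> NN" using T(1) by (force simp: MM_def NN_def)
    \<comment> \<open>Different triples may name the same point; repeating nonnegative terms only
      increases the sum.\<close>
    have "sum E F \<le> sum (E \<circ> pt) T"
      unfolding T(3) by (rule sum_image_le[OF T(2)]) (simp add: E_def)
    also have "\<dots> \<le> sum (E \<circ> pt) ({1..M} \<times> MM \<times> NN)"
      by (rule sum_mono2[OF _ sub]) (use fin in \<open>auto simp: E_def\<close>)
    also have "\<dots> = (\<Sum>k\<in>{1..M}. \<Sum>m\<in>MM. \<Sum>n\<in>NN. W \<epsilon> N k m n)"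
      by (simp add: E sum.cartesian_product split_def flip: E)
    also have "\<dots> \<le> (\<Sum>k\<in>{1..M}. a * (2 * \<epsilon>) * (2 * \<eta>\<^sup>2 * of_int (2 * N + 1) + 8 * (C k)\<^sup>2))"
      by (intro sum_mono \<epsilon>0(2) \<epsilon> N fin)
    also have "\<dots> = U"
      by (simp add: U_def C'_def sum.distrib algebra_simps flip: sum_distrib_left)
    finally show ?thesis .
  qed
  \<comment> \<open>In \<open>ennreal\<close> a sum is controlled by its finite partial sums, which
    is why finite index sets suffice in the energy bound.\<close>
  have "(\<Sum>\<^sub>\<infinity>\<gamma>\<in>?\<Gamma>. ennreal (E \<gamma>)) \<le> ennreal U"
  proof (rule infsum_le_finite_sums)
    fix F assume F: "finite F" "F \<subseteq> ?\<Gamma>"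
    have "(\<Sum>\<gamma>\<in>F. ennreal (E \<gamma>)) = ennreal (sum E F)"
      by (rule sum_ennreal) (simp add: E_def)
    also have "\<dots> \<le> ennreal U"
      using finite_sum[OF F] by (rule ennreal_leI)
    finally show "(\<Sum>\<gamma>\<in>F. ennreal (E \<gamma>)) \<le> ennreal U" .
  qed (rule nonneg_summable_on_complete, simp)
  moreover have "ennreal (A * L2_normsq f) \<le> (\<Sum>\<^sub>\<infinity>\<gamma>\<in>?\<Gamma>. ennreal (E \<gamma>))"
    unfolding E_def using A(2)[of f] comb_in_L2[OF \<epsilon>(2,1) N(1)] by (simp add: f_def)
  ultimately have "ennreal (A * L2_normsq f) \<le> ennreal U" by (rule order_trans[rotated])
  moreover have "U \<ge> 0"
    using C' \<epsilon> \<open>a > 0\<close> N by (auto simp: U_def intro!: mult_nonneg_nonneg add_nonneg_nonneg)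
  ultimately have "A * L2_normsq f \<le> U"
    by (simp add: ennreal_le_iff)
  also have "U < 2 * \<epsilon> * (A / 2 * of_int (2 * N + 1) + A / 2 * of_int (2 * N + 1))"
    unfolding U_def using \<epsilon> N \<eta>
    by (intro mult_strict_left_mono add_le_less_mono mult_right_mono) auto
  also have "\<dots> = A * L2_normsq f"
    unfolding f_def L2_normsq_comb[OF \<epsilon>(2,1) N(1)] by (simp add: algebra_simps)
  finally show False by simp
qed

section \<open>Zeros of the Zak transform of the third Hermite function\<close>

lemma deriv3_gaussian:
  "(deriv ^^ 3) (\<lambda>s::real. exp (- 2 * pi * s\<^sup>2)) t
    = (48 * pi\<^sup>2 * t - 64 * pi ^ 3 * t ^ 3) * exp (- 2 * pi * t\<^sup>2)"
proof -
  define E where "E s = exp (- 2 * pi * s\<^sup>2)" for s :: real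
  have E': "(E has_real_derivative - 4 * pi * s * E s) (at s)" for s
    unfolding E_def by (auto intro!: derivative_eq_intros)
  have "deriv E = (\<lambda>s. - 4 * pi * s * E s)"
    using E' by (intro ext DERIV_imp_deriv)
  moreover have "deriv (\<lambda>s. - 4 * pi * s * E s) = (\<lambda>s. (16 * pi\<^sup>2 * s\<^sup>2 - 4 * pi) * E s)"
    by (intro ext DERIV_imp_deriv)
      (auto intro!: derivative_eq_intros E' simp: algebra_simps power2_eq_square)
  moreover have "deriv (\<lambda>s. (16 * pi\<^sup>2 * s\<^sup>2 - 4 * pi) * E s)
      = (\<lambda>s. (48 * pi\<^sup>2 * s - 64 * pi ^ 3 * s ^ 3) * E s)"
    by (intro ext DERIV_imp_deriv)
      (auto intro!: derivative_eq_intros E' simp: algebra_simps power2_eq_square power3_eq_cube)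
  ultimately have "(deriv ^^ 3) E = (\<lambda>s. (48 * pi\<^sup>2 * s - 64 * pi ^ 3 * s ^ 3) * E s)"
    by (simp add: numeral_3_eq_3)
  then show ?thesis by (simp add: E_def[abs_def])
qed

lemma hermite_const_pos: "hermite_const n > 0"
  by (simp add: hermite_const_def)

lemma hermite_fun_3:
  "hermite_fun 3 t = 16 * pi\<^sup>2 * hermite_const 3 * (t * (4 * pi * t\<^sup>2 - 3) * exp (- pi * t\<^sup>2))"
proof -
  have "exp (pi * t\<^sup>2) * exp (- 2 * pi * t\<^sup>2) = exp (- pi * t\<^sup>2)"
    by (simp flip: exp_add)
  then show ?thesis
    unfolding hermite_fun_def deriv3_gaussian
    by (simp add: algebra_simps power2_eq_square power3_eq_cube)
qed

lemma exp_decay_hermite_fun_3: "exp_decay (\<lambda>t. complex_of_real (hermite_fun 3 t))"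
proof -
  define c where "c = 16 * pi\<^sup>2 * hermite_const 3"
  have c: "c \<ge> 0" using hermite_const_pos[of 3] by (simp add: c_def)
  have "norm (complex_of_real (hermite_fun 3 t)) \<le> c * (19 * exp 2) * exp (- \<bar>t\<bar>)" for t
  proof -
    have 1: "\<bar>t\<bar> \<le> exp \<bar>t\<bar>"
      using exp_ge_add_one_self[of "\<bar>t\<bar>"] by linarith
    \<comment> \<open>The constant 19 is 16 + 3, with 4 pi < 16.\<close>
    have 2: "\<bar>4 * pi * t\<^sup>2 - 3\<bar> \<le> 19 * exp (2 * \<bar>t\<bar>)"
    proof -
      have "t\<^sup>2 \<le> exp (2 * \<bar>t\<bar>)"
        using power_mono[OF 1, of 2] by (simp add: exp_of_nat_mult[symmetric] power2_abs)
      then have "4 * pi * t\<^sup>2 \<le> 16 * exp (2 * \<bar>t\<bar>)"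
        using mult_mono[of "4 * pi" 16 "t\<^sup>2" "exp (2 * \<bar>t\<bar>)"] pi_less_4 by simp
      moreover have "1 \<le> exp (2 * \<bar>t\<bar>)" by simp
      moreover have "0 \<le> 4 * pi * t\<^sup>2" by simp
      ultimately show ?thesis by linarith
    qed
    have "\<bar>t * (4 * pi * t\<^sup>2 - 3) * exp (- pi * t\<^sup>2)\<bar> = \<bar>t\<bar> * \<bar>4 * pi * t\<^sup>2 - 3\<bar> * exp (- pi * t\<^sup>2)"
      by (simp add: abs_mult)
    also have "\<dots> \<le> exp \<bar>t\<bar> * (19 * exp (2 * \<bar>t\<bar>)) * exp (- pi * t\<^sup>2)"
      by (intro mult_right_mono mult_mono 1 2) auto
    also have "\<dots> = 19 * exp (3 * \<bar>t\<bar> - pi * t\<^sup>2)"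
      by (simp flip: exp_add)
    also have "\<dots> \<le> 19 * exp (2 - \<bar>t\<bar>)"
    proof -
      have "3 * t\<^sup>2 \<le> pi * t\<^sup>2" using pi_gt3 by (intro mult_right_mono) auto
      \<comment> \<open>Completing the square bounds 4 |t| - 3 t^2 by 4 / 3, hence by 2.\<close>
      moreover have "0 \<le> 3 * (\<bar>t\<bar> - 2 / 3)\<^sup>2" by simp
      then have "0 \<le> 3 * t\<^sup>2 - 4 * \<bar>t\<bar> + 4 / 3" by (simp add: power2_diff power2_eq_square[of "2 / 3"])
      ultimately have "3 * \<bar>t\<bar> - pi * t\<^sup>2 \<le> 2 - \<bar>t\<bar>" by linarith
      then show ?thesis by simp
    qed
    also have "\<dots> = 19 * exp 2 * exp (- \<bar>t\<bar>)"
      by (simp flip: exp_add)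
    finally show ?thesis
      unfolding norm_of_real hermite_fun_3 c_def[symmetric] abs_mult[of c] abs_of_nonneg[OF c]
      using c by (simp add: mult.assoc mult_left_mono)
  qed
  then show ?thesis unfolding exp_decay_def by blast
qed

lemma continuous_on_hermite_fun_3: "continuous_on S (\<lambda>t. complex_of_real (hermite_fun 3 t))"
  unfolding hermite_fun_3 by (intro continuous_intros)

text \<open>Up to a positive constant, \<open>h3_profile\<close> is \<open>hermite_fun 3\<close> in the variable \<open>t = sqrt 3 * v\<close>, and \<open>zak_h3 e\<close> is
  the restriction of its Zak transform to the horizontal line at height \<open>- e / (2 * sqrt 3)\<close>;
  the factor \<open>cos (pi * e * j)\<close> is the sign \<open>(- 1) ^ (e * j)\<close>.\<close>

definition h3_profile :: "real \<Rightarrow> real" where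
  "h3_profile v = v * (4 * pi * v\<^sup>2 - 1) * exp (- 3 * pi * v\<^sup>2)"

definition zak_h3 :: "int \<Rightarrow> real \<Rightarrow> real" where
  "zak_h3 e v = (\<Sum>\<^sub>\<infinity>j. h3_profile (v + of_int j) * cos (pi * of_int e * of_int j))"

lemma h3_profile_minus: "h3_profile (- v) = - h3_profile v"
  by (simp add: h3_profile_def)

lemma hermite_fun_3_eq_profile:
  "hermite_fun 3 (sqrt 3 * v) = 48 * sqrt 3 * pi\<^sup>2 * hermite_const 3 * h3_profile v"
  unfolding hermite_fun_3 h3_profile_def by (simp add: power_mult_distrib algebra_simps)

text \<open>On these horizontal lines the phase is a multiple of pi, so its sine vanishes and every
  term is real. This is what makes the intermediate value theorem applicable.\<close>

lemma zak_term_hermite_fun_3: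
  fixes e j :: int
  shows "complex_of_real (hermite_fun 3 (sqrt 3 * v + sqrt 3 * of_int j))
      * cis (- 2 * pi * sqrt 3 * (- (of_int e / (2 * sqrt 3))) * of_int j)
    = of_real (48 * sqrt 3 * pi\<^sup>2 * hermite_const 3 * (h3_profile (v + of_int j) * cos (pi * of_int e * of_int j)))"
proof -
  have "sin (pi * of_int e * of_int j) = 0"
    using sin_int_times_real[of "e * j" pi] sin_zero_iff_int2
    by (metis mult.assoc mult.commute of_int_mult)
  then have "cis (pi * of_int e * of_int j) = of_real (cos (pi * of_int e * of_int j))"
    by (simp add: complex_eq_iff)
  moreover have "- 2 * pi * sqrt 3 * (- (of_int e / (2 * sqrt 3))) * of_int j = pi * of_int e * of_int j"
    by simp
  moreover have "sqrt 3 * v + sqrt 3 * of_int j = sqrt 3 * (v + of_int j)"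
    by (simp add: algebra_simps)
  ultimately show ?thesis
    by (simp only: hermite_fun_3_eq_profile of_real_mult mult.assoc)
qed

lemma zak_h3_summable: "(\<lambda>j. h3_profile (v + of_int j) * cos (pi * of_int e * of_int j)) summable_on UNIV"
proof -
  define k where "k = 48 * sqrt 3 * pi\<^sup>2 * hermite_const 3"
  have k: "k \<noteq> 0" using hermite_const_pos[of 3] by (simp add: k_def)
  have "(\<lambda>j. norm (complex_of_real (k * (h3_profile (v + of_int j) * cos (pi * of_int e * of_int j))))) summable_on UNIV"
    using zak_abs_summable[OF exp_decay_hermite_fun_3, of "sqrt 3" "sqrt 3 * v" "- (of_int e / (2 * sqrt 3))"]
    unfolding zak_term_hermite_fun_3 k_def by simp
  then have "(\<lambda>j. norm (k * (h3_profile (v + of_int j) * cos (pi * of_int e * of_int j)))) summable_on UNIV"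
    by (simp only: norm_of_real real_norm_def)
  then have "(\<lambda>j. k * (h3_profile (v + of_int j) * cos (pi * of_int e * of_int j))) summable_on UNIV"
    by (rule summable_on_iff_abs_summable_on_real[THEN iffD2])
  then show ?thesis
    using summable_on_cmult_right'[OF k] by (rule iffD1[rotated])
qed

lemma zak_hermite_fun_3:
  "zak (sqrt 3) (\<lambda>t. complex_of_real (hermite_fun 3 t)) (sqrt 3 * v) (- (of_int e / (2 * sqrt 3)))
    = of_real (48 * sqrt 3 * pi\<^sup>2 * hermite_const 3 * zak_h3 e v)"
  unfolding zak_def zak_term_hermite_fun_3 zak_h3_def
  by (intro infsumI has_sum_of_real has_sum_cmult_right has_sum_infsum zak_h3_summable)

text \<open>The profile is odd and the cosine is even under replacing \<open>j\<close> by
  \<open>- j\<close>.\<close>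

lemma zak_h3_minus: "zak_h3 e (- v) = - zak_h3 e v"
proof -
  have "zak_h3 e (- v) = (\<Sum>\<^sub>\<infinity>j. h3_profile (- v + of_int (- j)) * cos (pi * of_int e * of_int (- j)))"
    unfolding zak_h3_def by (rule infsum_reindex_bij_betw[symmetric]) (rule bij_uminus)
  also have "\<dots> = (\<Sum>\<^sub>\<infinity>j. - (h3_profile (v + of_int j) * cos (pi * of_int e * of_int j)))"
  proof (rule infsum_cong)
    fix j :: int
    have "h3_profile (- v + of_int (- j)) = - h3_profile (v + of_int j)"
      using h3_profile_minus[of "v + of_int j"] by (simp add: algebra_simps)
    then show "h3_profile (- v + of_int (- j)) * cos (pi * of_int e * of_int (- j))
        = - (h3_profile (v + of_int j) * cos (pi * of_int e * of_int j))" by simp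
  qed
  finally show ?thesis by (simp add: zak_h3_def infsum_uminus)
qed

lemma zak_h3_0_plus_1: "zak_h3 0 (v + 1) = zak_h3 0 v"
proof -
  have "zak_h3 0 (v + 1) = (\<Sum>\<^sub>\<infinity>j::int. h3_profile (v + of_int (j + 1)))"
    by (simp add: zak_h3_def add_ac)
  also have "\<dots> = (\<Sum>\<^sub>\<infinity>j::int. h3_profile (v + of_int j))"
    by (rule infsum_reindex_bij_betw) (rule bij_plus_right)
  finally show ?thesis by (simp add: zak_h3_def)
qed

text \<open>By periodicity the values at 1 / 2 and -1 / 2 agree, by oddness they are opposite. For
  \<open>e = 1\<close> translation by 1 changes the sign, and the same argument yields
  nothing.\<close>

lemma zak_h3_0_half: "zak_h3 0 (1 / 2) = 0"
  using zak_h3_0_plus_1[of "- 1 / 2"] zak_h3_minus[of 0 "1 / 2"] by simp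

lemma continuous_on_zak_h3: "continuous_on S (zak_h3 e)"
proof -
  define k where "k = 48 * sqrt 3 * pi\<^sup>2 * hermite_const 3"
  have k: "k \<noteq> 0" using hermite_const_pos[of 3] by (simp add: k_def)
  have "continuous_on S (\<lambda>v. Re (zak (sqrt 3) (\<lambda>t. complex_of_real (hermite_fun 3 t)) (sqrt 3 * v)
      (- (of_int e / (2 * sqrt 3)))) / k)"
    by (intro continuous_intros continuous_on_compose2[OF continuous_on_zak[OF exp_decay_hermite_fun_3 _ continuous_on_hermite_fun_3]])
      (auto simp: k)
  then show ?thesis
    unfolding zak_hermite_fun_3 k_def[symmetric] using k by simp
qed

section \<open>Numerical estimates and sign changes\<close>

lemma exp_1_ge: "27 / 10 \<le> exp (1 :: real)"
proof -
  have "inverse (2 ^ 32) \<le> (1 / 100 :: real)" by simp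
  with e_approx_32 show ?thesis by linarith
qed

text \<open>From v^2 >= 2 |v| - 1 and |v| <= exp(|v| - 1) the Gaussian tail is dominated by a pure
  exponential, which sums geometrically over translates. The exponent is 3 (|v| - 1) + 9 - 18
  |v|.\<close>

lemma h3_profile_tail_bound:
  assumes "\<bar>v\<bar> \<ge> 1"
  shows "\<bar>h3_profile v\<bar> \<le> 13 * exp (6 - 15 * \<bar>v\<bar>)"
proof -
  let ?x = "\<bar>v\<bar>"
  have pi: "3 \<le> pi" "4 * pi \<le> 13" using pi_approx by auto
  have "1 \<le> v\<^sup>2"
    using one_le_power[OF assms, of 2] by simp
  then have "1 * 1 \<le> 4 * pi * v\<^sup>2"
    using pi by (intro mult_mono) auto
  then have "\<bar>h3_profile v\<bar> \<le> ?x * (4 * pi * v\<^sup>2) * exp (- 3 * pi * v\<^sup>2)"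
    unfolding h3_profile_def by (auto simp: abs_mult intro!: mult_right_mono mult_left_mono)
  also have "\<dots> = 4 * pi * ?x ^ 3 * exp (- 3 * pi * v\<^sup>2)"
    by (simp add: power3_eq_cube power2_eq_square)
  also have "\<dots> \<le> 13 * exp (?x - 1) ^ 3 * exp (9 - 18 * ?x)"
  proof (intro mult_mono power_mono)
    show "?x \<le> exp (?x - 1)" using exp_ge_add_one_self[of "?x - 1"] by simp
    have "0 \<le> (?x - 1)\<^sup>2" by simp
    then have "2 * ?x - 1 \<le> v\<^sup>2" by (simp add: power2_diff)
    then have "9 * (2 * ?x - 1) \<le> 3 * pi * v\<^sup>2"
      using assms pi by (intro mult_mono) auto
    then show "exp (- 3 * pi * v\<^sup>2) \<le> exp (9 - 18 * ?x)" by simp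
  qed (use pi in auto)
  also have "\<dots> = 13 * exp (6 - 15 * ?x)"
    by (simp add: exp_of_nat_mult[symmetric] flip: exp_add)
  finally show ?thesis .
qed

text \<open>For these \<open>v\<close> the translates closest to 0 are \<open>v\<close> and
  \<open>v - 1\<close>, the terms \<open>j = 0\<close> and \<open>j = - 1\<close>; oddness of the
  profile turns the second into \<open>h3_profile (1 - v)\<close> with a minus sign. All other
  translates have modulus at least 7 / 6 and fall under the tail bound.\<close>

lemma zak_h3_approx:
  assumes "1 / 6 \<le> v" "v \<le> 1 / 2"
  shows "\<bar>zak_h3 e v - (h3_profile v - cos (pi * of_int e) * h3_profile (1 - v))\<bar> \<le> 1 / 1000"
proof -
  define T where "T j = h3_profile (v + of_int j) * cos (pi * of_int e * of_int j)" for j :: int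
  \<comment> \<open>Here - 23 / 2 = 6 - 15 * 7 / 6. Of the decay exp(- 15 n) only the weaker (1 /
    2)^n is kept.\<close>
  define b :: "nat \<Rightarrow> real" where "b n = 13 * exp (- 23 / 2) * (1 / 2) ^ n" for n
  have small: "\<bar>h3_profile w\<bar> \<le> b n" if "\<bar>w\<bar> \<ge> real n + 7 / 6" for w n
  proof -
    have "\<bar>h3_profile w\<bar> \<le> 13 * exp (6 - 15 * \<bar>w\<bar>)" using that by (intro h3_profile_tail_bound) auto
    also have "\<dots> \<le> 13 * exp (- 23 / 2 + real n * (- 1))" using that by simp
    also have "exp (- 23 / 2 + real n * (- 1)) = exp (- 23 / 2) * exp (- 1) ^ n"
      by (simp only: exp_add exp_of_nat_mult)
    also have "exp (- 1) ^ n \<le> (1 / 2 :: real) ^ n"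
    proof (rule power_mono)
      show "exp (- 1) \<le> (1 / 2 :: real)"
        using exp_ge_add_one_self[of "1 :: real"] by (simp add: exp_minus field_simps)
    qed simp
    finally show ?thesis by (simp add: b_def)
  qed
  have b_sum: "(b has_sum 26 * exp (- 23 / 2)) UNIV"
  proof (rule sums_nonneg_imp_has_sum)
    show "b sums (26 * exp (- 23 / 2))"
      unfolding b_def using sums_mult[OF geometric_sums[of "1 / 2 :: real"], of "13 * exp (- 23 / 2)"] by simp
  qed (simp add: b_def)
  \<comment> \<open>The translates to the right start at 1 + v >= 7 / 6, those to the left at 2 - v
    >= 3 / 2 in modulus.\<close>
  let ?P = "range (\<lambda>n. int n + 1)" and ?N = "range (\<lambda>n. - int n - 2)"
  have part: "\<bar>infsum T (range h)\<bar> \<le> 26 * exp (- 23 / 2)" if "inj h" "\<And>n. \<bar>v + of_int (h n)\<bar> \<ge> real n + 7 / 6"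
    for h :: "nat \<Rightarrow> int"
  proof -
    have "infsum T (range h) = infsum (T \<circ> h) UNIV"
      using that(1) by (rule infsum_reindex)
    also have "norm \<dots> \<le> 26 * exp (- 23 / 2)"
    proof (rule norm_infsum_le[OF has_sum_infsum b_sum])
      have "T summable_on range h"
        using zak_h3_summable[of v e] unfolding T_def by (rule summable_on_subset_banach) simp
      then show "T \<circ> h summable_on UNIV"
        by (simp add: summable_on_reindex[OF that(1)])
      show "norm ((T \<circ> h) n) \<le> b n" for n
      proof -
        have "norm ((T \<circ> h) n) \<le> \<bar>h3_profile (v + of_int (h n))\<bar> * 1"
          unfolding T_def o_def real_norm_def abs_mult by (intro mult_left_mono) auto
        with small[OF that(2)[of n]] show ?thesis by simp
      qed
    qed
    finally show ?thesis by simp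
  qed
  have split: "(UNIV :: int set) = {0, - 1} \<union> (?P \<union> ?N)"
  proof -
    have "j = 0 \<or> j = - 1 \<or> j = int (nat (j - 1)) + 1 \<or> j = - int (nat (- j - 2)) - 2" for j :: int
      by linarith
    then show ?thesis by blast
  qed
  have summ: "T summable_on A" for A
    using zak_h3_summable[of v e] unfolding T_def by (rule summable_on_subset_banach) simp
  have "zak_h3 e v = infsum T ({0, - 1} \<union> (?P \<union> ?N))"
    unfolding zak_h3_def T_def using split by simp
  also have "\<dots> = infsum T {0, - 1} + (infsum T ?P + infsum T ?N)"
    using summ by (subst infsum_Un_disjoint; (subst infsum_Un_disjoint)?) auto
  also have "infsum T {0, - 1} = h3_profile v - cos (pi * of_int e) * h3_profile (1 - v)"
    using h3_profile_minus[of "1 - v"] by (simp add: T_def algebra_simps)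
  finally have "zak_h3 e v - (h3_profile v - cos (pi * of_int e) * h3_profile (1 - v)) = infsum T ?P + infsum T ?N"
    by simp
  moreover have "\<bar>infsum T ?P\<bar> \<le> 26 * exp (- 23 / 2)"
    by (rule part) (use assms in \<open>auto simp: inj_on_def\<close>)
  moreover have "\<bar>infsum T ?N\<bar> \<le> 26 * exp (- 23 / 2)"
    by (rule part) (use assms in \<open>auto simp: inj_on_def\<close>)
  \<comment> \<open>With 52000 the two tails add up to at most 2 * 26 / 52000 = 1 / 1000.\<close>
  moreover have "exp (- 23 / 2) \<le> 1 / (52000 :: real)"
  proof -
    have "(52000 :: real) \<le> (27 / 10) ^ 11" by (simp add: eval_nat_numeral)
    also have "\<dots> \<le> exp 1 ^ 11"
      using exp_1_ge by (intro power_mono) auto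
    also have "\<dots> = exp 11" by (simp flip: exp_of_nat_mult)
    also have "\<dots> \<le> exp (23 / 2)" by simp
    finally show ?thesis by (simp add: exp_minus field_simps)
  qed
  ultimately show ?thesis by linarith
qed

text \<open>As \<open>h3_profile (5 / 6)\<close> is positive, the plus sign is the worse case, so
  the two facts settle the sign of the approximation at 1 / 6 on both lines.\<close>

lemma h3_profile_sixth: "h3_profile (1 / 6) + h3_profile (5 / 6) < - 1 / 100" "h3_profile (5 / 6) > 0"
proof -
  have pi: "3 \<le> pi" "pi \<le> 16 / 5" using pi_approx by auto
  \<comment> \<open>Both factors are estimated from below by inserting the upper bound 16 / 5 for
    pi, after exp(- x) >= 1 - x.\<close>
  have "(1 - 16 / 5 / 9) * (1 - 16 / 5 / 12) \<le> (1 - pi / 9) * exp (- (pi / 12))"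
    using pi exp_minus_ge[of "pi / 12"] by (intro mult_mono) auto
  moreover have "h3_profile (1 / 6) = - (1 / 6) * ((1 - pi / 9) * exp (- (pi / 12)))"
    by (simp add: h3_profile_def power2_eq_square algebra_simps)
  ultimately have 1: "h3_profile (1 / 6) \<le> - (1 / 6) * ((1 - 16 / 5 / 9) * (1 - 16 / 5 / 12))"
    by linarith
  have eq: "h3_profile (5 / 6) = 5 / 6 * (25 * pi / 9 - 1) * exp (- (25 * pi / 12))"
    by (simp add: h3_profile_def power2_eq_square algebra_simps)
  then show "h3_profile (5 / 6) > 0" unfolding eq using pi by (intro mult_pos_pos) auto
  have "exp (- (25 * pi / 12)) \<le> exp (- 6)" using pi by simp
  also have "exp (- 6) \<le> 1 / (240 :: real)"
  proof -
    have "(240 :: real) \<le> (5 / 2) ^ 6" by (simp add: eval_nat_numeral)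
    also have "\<dots> \<le> exp 1 ^ 6"
      using exp_1_ge by (intro power_mono) auto
    also have "\<dots> = exp 6" by (simp flip: exp_of_nat_mult)
    finally show ?thesis by (simp add: exp_minus field_simps)
  qed
  finally have "exp (- (25 * pi / 12)) \<le> 1 / 240" .
  then have "h3_profile (5 / 6) \<le> 5 / 6 * (25 * (16 / 5) / 9 - 1) * (1 / 240)"
    unfolding eq using pi by (intro mult_mono) auto
  with 1 show "h3_profile (1 / 6) + h3_profile (5 / 6) < - 1 / 100" by simp
qed

text \<open>Here the minus sign is the worse case. The Gaussian factors at 5 / 12 and 7 / 12 have
  ratio exp(pi / 2), since 49 / 48 - 25 / 48 = 1 / 2; with the smaller one factored out, lower
  bounds for \<open>E\<close> and for this ratio suffice.\<close>

lemma h3_profile_five_twelfths: "h3_profile (5 / 12) - h3_profile (7 / 12) > 1 / 1000" "h3_profile (7 / 12) > 0"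
proof -
  have pi: "3.14 \<le> pi" "pi \<le> 3.15" using pi_approx by auto
  define E where "E = exp (- (49 * pi / 48))"
  have 7: "h3_profile (7 / 12) = 7 / 12 * (49 * pi / 36 - 1) * E"
    by (simp add: h3_profile_def E_def power2_eq_square algebra_simps)
  have "exp (- (25 * pi / 48)) = exp (pi / 2) * E"
    unfolding E_def by (simp flip: exp_add)
  then have 5: "h3_profile (5 / 12) = 5 / 12 * (25 * pi / 36 - 1) * exp (pi / 2) * E"
    by (simp add: h3_profile_def power2_eq_square algebra_simps)
  show "h3_profile (7 / 12) > 0" unfolding 7 using pi by (intro mult_pos_pos) (auto simp: E_def)
  have E: "E \<ge> 1 / 60"
  proof -
    have "exp (49 * pi / 48) \<le> exp 4" using pi by simp
    also have "exp (4 :: real) = exp 1 ^ 4" by (simp flip: exp_of_nat_mult)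
    also have "\<dots> \<le> (2.75 :: real) ^ 4" using e_less_272 by (intro power_mono) auto
    also have "\<dots> \<le> 60" by (simp add: eval_nat_numeral)
    finally have "exp (49 * pi / 48) \<le> 60" .
    then show ?thesis by (simp add: E_def exp_minus field_simps)
  qed
  \<comment> \<open>The quadratic Taylor bound is used at 0.785 = 3.14 / 4 and then squared; applied
    directly at 1.57 it would stay below 4.3.\<close>
  have "(209 / 100)\<^sup>2 \<le> exp (0.785 :: real) ^ 2"
    using exp_lower_Taylor_quadratic[of "0.785"] by (intro power_mono) (auto simp: power2_eq_square)
  also have "\<dots> = exp (1.57)" by (simp flip: exp_of_nat_mult)
  also have "\<dots> \<le> exp (pi / 2)" using pi by simp
  finally have e: "4.3 \<le> exp (pi / 2)" by (simp add: power2_eq_square)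
  define X where "X = 5 / 12 * (25 * pi / 36 - 1) * exp (pi / 2)"
  have "5 / 12 * (25 * 3.14 / 36 - 1) * 4.3 \<le> X"
    unfolding X_def using pi e by (intro mult_mono) auto
  then have D: "1 / 10 \<le> X - 7 / 12 * (49 * pi / 36 - 1)" (is "_ \<le> ?D")
    using pi by (simp add: field_simps)
  have "1 / 10 * (1 / 60) \<le> ?D * E"
    by (rule mult_mono[OF D E]) (use D in linarith, simp)
  also have "\<dots> = h3_profile (5 / 12) - h3_profile (7 / 12)"
    unfolding 5 7 X_def by (simp add: left_diff_distrib)
  finally show "h3_profile (5 / 12) - h3_profile (7 / 12) > 1 / 1000" by simp
qed

text \<open>The root lies strictly between 0 and 1 / 2, so \<theta> and -\<theta> differ modulo 1
  from each other and from 0 and 1 / 2.\<close>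

lemma zak_h3_root:
  assumes "e \<in> {0, 1}"
  obtains \<theta> where "1 / 6 < \<theta>" "\<theta> < 5 / 12" "zak_h3 e \<theta> = 0"
proof -
  define c where "c = cos (pi * of_int e)"
  have c: "c = 1 \<or> c = - 1" using assms by (auto simp: c_def)
  have neg: "zak_h3 e (1 / 6) < 0"
  proof -
    have "\<bar>zak_h3 e (1 / 6) - (h3_profile (1 / 6) - c * h3_profile (5 / 6))\<bar> \<le> 1 / 1000"
      using zak_h3_approx[of "1 / 6" e] by (simp add: c_def)
    moreover have "h3_profile (1 / 6) - c * h3_profile (5 / 6) < - 1 / 100" using c h3_profile_sixth by auto
    ultimately show ?thesis by linarith
  qed
  moreover have pos: "zak_h3 e (5 / 12) > 0"
  proof -
    have "\<bar>zak_h3 e (5 / 12) - (h3_profile (5 / 12) - c * h3_profile (7 / 12))\<bar> \<le> 1 / 1000"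
      using zak_h3_approx[of "5 / 12" e] by (simp add: c_def)
    moreover have "h3_profile (5 / 12) - c * h3_profile (7 / 12) > 1 / 1000" using c h3_profile_five_twelfths by auto
    ultimately show ?thesis by linarith
  qed
  ultimately obtain \<theta> where \<theta>: "1 / 6 \<le> \<theta>" "\<theta> \<le> 5 / 12" "zak_h3 e \<theta> = 0"
    using IVT'[of "zak_h3 e" "1 / 6" 0 "5 / 12"] continuous_on_zak_h3[of "{1 / 6..5 / 12}" e] by auto
  moreover have "\<theta> \<noteq> 1 / 6" "\<theta> \<noteq> 5 / 12"
    using \<theta>(3) neg pos by (metis less_irrefl)+
  ultimately show ?thesis using that[of \<theta>] by linarith
qed

section \<open>Seven zeros in distinct cosets of the lattice\<close>

theorem mainTheorem6:
  shows "\<exists>z :: nat \<Rightarrow> real \<times> real.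
    has_periodic_density (sqrt 3, 0) (0, 1 / sqrt 3) 7 z 7 \<and>
    \<not> gabor_frame (\<lambda>t. complex_of_real (hermite_fun 3 t))
        (periodic_structure (sqrt 3, 0) (0, 1 / sqrt 3) 7 z)"
proof -
  obtain \<theta> where \<theta>: "1 / 6 < \<theta>" "\<theta> < 5 / 12" "zak_h3 0 \<theta> = 0" by (rule zak_h3_root[of 0]) auto
  obtain \<theta>' where \<theta>': "1 / 6 < \<theta>'" "\<theta>' < 5 / 12" "zak_h3 1 \<theta>' = 0" by (rule zak_h3_root[of 1]) auto
  \<comment> \<open>A pair \<open>(v, e)\<close> stands for the point
    \<open>(sqrt 3 * v, e / (2 * sqrt 3))\<close>. The first three come from symmetry, the others
    from the sign changes. All \<open>v\<close> are representatives modulo 1 in the half-open window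
    (-1/2, 1/2], and all \<open>e\<close> modulo 2 in {0, 1}, so distinct entries lie in distinct
    cosets.\<close>
  define L :: "(real \<times> int) list" where
    "L = [(0, 0), (1 / 2, 0), (0, 1), (\<theta>, 0), (- \<theta>, 0), (\<theta>', 1), (- \<theta>', 1)]"
  have Z0: "zak_h3 e 0 = 0" for e using zak_h3_minus[of e 0] by simp
  have half: "zak_h3 0 v = 0" if "v * 2 = 1" for v
  proof -
    have "v = 1 / 2" using that by simp
    then show ?thesis by (simp only: zak_h3_0_half)
  qed
  have L: "distinct L" "length L = 7"
    "\<And>v e. (v, e) \<in> set L \<Longrightarrow> - 1 / 2 < v \<and> v \<le> 1 / 2 \<and> e \<in> {0, 1} \<and> zak_h3 e (- v) = 0"
    using \<theta> \<theta>' Z0 half by (auto simp: L_def zak_h3_minus)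
  \<comment> \<open>The points are numbered from 1, the list entries from 0.\<close>
  define v where "v k = fst (L ! (k - 1))" for k
  define e where "e k = snd (L ! (k - 1))" for k
  define z where "z k = (sqrt 3 * v k, of_int (e k) / (2 * sqrt 3))" for k
  have ve: "- 1 / 2 < v k" "v k \<le> 1 / 2" "e k \<in> {0, 1}" "zak_h3 (e k) (- v k) = 0" if "k \<in> {1..7}" for k
  proof -
    have "(v k, e k) \<in> set L"
      unfolding v_def e_def prod.collapse using that L(2) by (intro nth_mem) auto
    from L(3)[OF this] show "- 1 / 2 < v k" "v k \<le> 1 / 2" "e k \<in> {0, 1}" "zak_h3 (e k) (- v k) = 0" by auto
  qed
  have "z j - z k \<notin> lattice_of (sqrt 3, 0) (0, 1 / sqrt 3)" if jk: "j \<in> {1..7}" "k \<in> {1..7}" "j \<noteq> k" for j k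
  proof
    assume "z j - z k \<in> lattice_of (sqrt 3, 0) (0, 1 / sqrt 3)"
    then obtain m n :: int where mn: "sqrt 3 * v j - sqrt 3 * v k = sqrt 3 * of_int m"
      "of_int (e j) / (2 * sqrt 3) - of_int (e k) / (2 * sqrt 3) = 1 / sqrt 3 * of_int n"
      unfolding lattice_of_rectangular z_def by auto
    have "v j - v k = of_int m"
      using mn(1) by (simp flip: right_diff_distrib)
    moreover from this have "- 1 < real_of_int m" "real_of_int m < 1"
      using ve(1,2)[OF jk(1)] ve(1,2)[OF jk(2)] by linarith+
    then have "m = 0" by linarith
    ultimately have "v j = v k" by simp
    \<comment> \<open>The height unit 1 / (2 sqrt 3) is half a lattice step, so heights in the same
      coset have \<open>e\<close> of the same parity.\<close>
    moreover have "of_int (e j - e k) * sqrt 3 = of_int (2 * n) * sqrt 3"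
      using mn(2) by (simp add: field_simps)
    then have "of_int (e j - e k) = (of_int (2 * n) :: real)"
      by (rule mult_right_cancel[THEN iffD1, rotated]) simp
    then have "even (e j - e k)" by (simp only: of_int_eq_iff dvd_triv_left)
    with ve(3)[OF jk(1)] ve(3)[OF jk(2)] have "e j = e k" by auto
    ultimately have "L ! (j - 1) = L ! (k - 1)"
      by (simp add: v_def e_def prod_eq_iff)
    then have "j - 1 = k - 1"
      using L(1,2) jk by (subst (asm) nth_eq_iff_index_eq) auto
    with jk show False by auto
  qed
  then have "has_periodic_density (sqrt 3, 0) (0, 1 / sqrt 3) 7 z 7"
    unfolding has_periodic_density_7_iff by blast
  moreover have "\<not> gabor_frame (\<lambda>t. complex_of_real (hermite_fun 3 t))
      (periodic_structure (sqrt 3, 0) (0, 1 / sqrt 3) 7 z)"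
  proof (rule not_gabor_frame_if_zak_zeros[OF continuous_on_hermite_fun_3 exp_decay_hermite_fun_3])
    fix k :: nat assume "k \<in> {1..7}"
    then show "zak (sqrt 3) (\<lambda>t. complex_of_real (hermite_fun 3 t)) (- fst (z k)) (- snd (z k)) = 0"
      \<comment> \<open>Both coordinates are negated: the height \<open>- e / (2 * sqrt 3)\<close>
        is the one built into \<open>zak_h3\<close>, and the profile variable becomes
        \<open>- v k\<close>.\<close>
      using zak_hermite_fun_3[of "- v k" "e k"] ve(4) by (simp add: z_def)
  qed simp
  ultimately show ?thesis by blast
qed

end
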